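(* Let $n\ge2$. There exists a one-parameter family $\{\Sigma_r\,;\,0<r<\pi/2\}$ of properly embedded Delaunay-type rotational catenoids in $\mathbb{S}^n\times\mathbb{R}$; that is, each $\Sigma_r$ is a properly embedded rotational vertical catenoid which is periodic, homeomorphic to $\mathbb{S}^{n-1}\times\mathbb{R}$, and has unduloids as the trajectories of the gradient of its height function.
   Context: $\mathbb{S}^n$ is the unit sphere and $\mathbb{S}^n\times\mathbb{R}$ carries the product metric with Levi-Civita connection $\overline\nabla$; $\partial_t$ is the unit vertical field. For a hypersurface $\Sigma\subset\mathbb{S}^n\times\mathbb{R}$ with unit normal $N$, the shape operator is $AX=-\overline\nabla_XN$, the height function $\xi$ is the restriction to $\Sigma$ of the projection onto $\mathbb{R}$, with gradient $\nabla\xi$ on $\Sigma$, and $\Theta=\langle N,\partial_t\rangle$ is the angle function. A horizontal point is a critical point of $\xi$ (a point where $\Theta^2=1$). A horizontal section of $\Sigma$ is $\Sigma_t=\Sigma\cap(\mathbb{S}^n\times\{t\})$ when the intersection is transversal; its (non normalized) mean curvature $H_{\Sigma_t}$, as a hypersurface of $\mathbb{S}^n\times\{t\}$, is taken with respect to the unit normal $\eta=-(1-\Theta^2)^{-1/2}(N-\Theta\partial_t)$. Vertical catenoid: a hypersurface $\Sigma$ with no horizontal points and nonconstant angle function such that (i) $\nabla\xi$ is a principal direction of $\Sigma$ with principal curvature $\lambda\ne0$; and (ii) every horizontal section $\Sigma_t\subset\Sigma$ has nonzero constant mean curvature (i.e., depending only on $t$) given by $H_{\Sigma_t}=\lambda/\sqrt{1-\Theta^2}$.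 $\Sigma$ is rotational if there is a fixed point $o\in\mathbb{S}^n$ such that every horizontal section $\Sigma_t$ is contained in a geodesic sphere centered at $(o,t)$; $\{o\}\times\mathbb{R}$ is the axis. A rotational catenoid is a vertical catenoid which is rotational. Periodic means invariant under a nontrivial vertical translation $(p,t)\mapsto(p,t+T)$. A trajectory of $\nabla\xi$ is an unduloid if it is a curve of the form $t\mapsto(\gamma(\rho(t)),t)$, $t\in\mathbb{R}$, where $\gamma$ is a unit-speed geodesic of $\mathbb{S}^n$ issuing from $o$ and $\rho$ is a nonconstant smooth periodic function with values in a compact subinterval of $(0,\pi)$.
   Formalization: The principal curvature λ and the mean curvature of the horizontal sections are required to be nonzero only off a locally finite set of heights, since with unduloid trajectories λ must vanish somewhere (here on the sections that are great spheres). *)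

theory Defs
  imports "HOL-Analysis.Analysis"
begin

text \<open>
  The sphere of dimension n is the unit sphere of a Euclidean space of dimension n + 1, and its
  product with the real line is a submanifold of \<^typ>\<open>'a \<times> real\<close>; the induced metric is the
  product metric.
\<close>

section \<open>Submanifolds of Euclidean space\<close>

fun Ck_on :: "nat \<Rightarrow> 'a::euclidean_space set \<Rightarrow> ('a \<Rightarrow> 'b::euclidean_space) \<Rightarrow> bool" where
  "Ck_on 0 U f \<longleftrightarrow> continuous_on U f"
| "Ck_on (Suc k) U f \<longleftrightarrow>
     (\<exists>f'. (\<forall>x\<in>U. (f has_derivative f' x) (at x)) \<and> (\<forall>v. Ck_on k U (\<lambda>x. f' x v)))"

text \<open>On a set that need not be open, smooth means: locally the restriction of a smooth map
  defined on an open set.\<close>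

definition smooth_on :: "'a::euclidean_space set \<Rightarrow> ('a \<Rightarrow> 'b::euclidean_space) \<Rightarrow> bool" where
  "smooth_on S f \<longleftrightarrow>
     (\<forall>p\<in>S. \<exists>U g. open U \<and> p \<in> U \<and> (\<forall>k. Ck_on k U g) \<and> (\<forall>q\<in>S \<inter> U. g q = f q))"

definition tangent_space :: "'a::euclidean_space set \<Rightarrow> 'a \<Rightarrow> 'a set" where
  "tangent_space S p =
     {v. \<exists>c e. e > (0::real) \<and> smooth_on {-e<..<e} c \<and> c ` {-e<..<e} \<subseteq> S \<and> c 0 = p \<and>
         (c has_vector_derivative v) (at 0)}"

text \<open>Embedded hypersurfaces of \<open>M\<close> are locally regular level sets in \<open>M\<close>.\<close>

definition hypersurface :: "'a::euclidean_space set \<Rightarrow> 'a set \<Rightarrow> bool" where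
  "hypersurface M S \<longleftrightarrow> S \<noteq> {} \<and> S \<subseteq> M \<and>
     (\<forall>p\<in>S. \<exists>U (f :: 'a \<Rightarrow> real). open U \<and> p \<in> U \<and> smooth_on U f \<and>
        S \<inter> U = {q \<in> M \<inter> U. f q = 0} \<and>
        (\<forall>q\<in>S \<inter> U. \<exists>v\<in>tangent_space M q. frechet_derivative f (at q) v \<noteq> 0))"

definition properly_embedded :: "'a::euclidean_space set \<Rightarrow> 'a set \<Rightarrow> bool" where
  "properly_embedded M S \<longleftrightarrow>
     hypersurface M S \<and> (\<forall>K. K \<subseteq> M \<and> compact K \<longrightarrow> compact (S \<inter> K))"

definition orth_proj :: "'a::euclidean_space set \<Rightarrow> 'a \<Rightarrow> 'a" where
  "orth_proj T x = (THE y. y \<in> T \<and> (\<forall>u\<in>T. (x - y) \<bullet> u = 0))"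

text \<open>
  The Levi-Civita connection of a submanifold \<open>M\<close> of Euclidean space is the tangential part of the
  flat derivative. Here it is applied to a field \<open>V\<close> along \<open>S \<subseteq> M\<close> and a vector \<open>v\<close> tangent to
  \<open>S\<close>. A derivative of \<open>V\<close> relative to \<open>S\<close> is not unique as a linear map on the whole space, but
  its value at a vector tangent to \<open>S\<close> does not depend on the choice.
\<close>

definition cov_deriv ::
  "'a::euclidean_space set \<Rightarrow> 'a set \<Rightarrow> ('a \<Rightarrow> 'a) \<Rightarrow> 'a \<Rightarrow> 'a \<Rightarrow> 'a" where
  "cov_deriv M S V p v = orth_proj (tangent_space M p) (frechet_derivative V (at p within S) v)"

definition unit_normal ::
  "'a::euclidean_space set \<Rightarrow> 'a set \<Rightarrow> ('a \<Rightarrow> 'a) \<Rightarrow> bool" where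
  "unit_normal M S N \<longleftrightarrow> smooth_on S N \<and>
     (\<forall>p\<in>S. N p \<in> tangent_space M p \<and> norm (N p) = 1 \<and> (\<forall>v\<in>tangent_space S p. N p \<bullet> v = 0))"

definition shape_operator ::
  "'a::euclidean_space set \<Rightarrow> 'a set \<Rightarrow> ('a \<Rightarrow> 'a) \<Rightarrow> 'a \<Rightarrow> 'a \<Rightarrow> 'a" where
  "shape_operator M S N p v = - cov_deriv M S N p v"

definition orthonormal_basis :: "'a::euclidean_space set \<Rightarrow> 'a set \<Rightarrow> bool" where
  "orthonormal_basis T B \<longleftrightarrow> pairwise orthogonal B \<and> (\<forall>b\<in>B. norm b = 1) \<and> span B = T"

definition trace_on :: "'a::euclidean_space set \<Rightarrow> ('a \<Rightarrow> 'a) \<Rightarrow> real" where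
  "trace_on T A = (\<Sum>b\<in>(SOME B. orthonormal_basis T B). A b \<bullet> b)"

text \<open>Not normalized: the trace, not the average.\<close>

definition mean_curvature ::
  "'a::euclidean_space set \<Rightarrow> 'a set \<Rightarrow> ('a \<Rightarrow> 'a) \<Rightarrow> 'a \<Rightarrow> real" where
  "mean_curvature M S N p = trace_on (tangent_space S p) (shape_operator M S N p)"

definition gradient_on :: "'a::euclidean_space set \<Rightarrow> ('a \<Rightarrow> real) \<Rightarrow> 'a \<Rightarrow> 'a" where
  "gradient_on S f p = (THE g. g \<in> tangent_space S p \<and>
     (\<forall>v\<in>tangent_space S p. g \<bullet> v = frechet_derivative f (at p within S) v))"

definition unit_speed_geodesic :: "'a::euclidean_space set \<Rightarrow> (real \<Rightarrow> 'a) \<Rightarrow> bool" where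
  "unit_speed_geodesic M \<gamma> \<longleftrightarrow> range \<gamma> \<subseteq> M \<and>
     (\<exists>\<gamma>' \<gamma>''. \<forall>s. (\<gamma> has_vector_derivative \<gamma>' s) (at s) \<and> (\<gamma>' has_vector_derivative \<gamma>'' s) (at s) \<and>
        norm (\<gamma>' s) = 1 \<and> orth_proj (tangent_space M (\<gamma> s)) (\<gamma>'' s) = 0)"

definition integral_curve ::
  "'a::euclidean_space set \<Rightarrow> ('a \<Rightarrow> 'a) \<Rightarrow> real set \<Rightarrow> (real \<Rightarrow> 'a) \<Rightarrow> bool" where
  "integral_curve S V I \<alpha> \<longleftrightarrow> open I \<and> is_interval I \<and> I \<noteq> {} \<and>
     (\<forall>s\<in>I. \<alpha> s \<in> S \<and> (\<alpha> has_vector_derivative V (\<alpha> s)) (at s))"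

text \<open>Trajectories are the images of the maximal integral curves.\<close>

definition trajectory ::
  "'a::euclidean_space set \<Rightarrow> ('a \<Rightarrow> 'a) \<Rightarrow> 'a set \<Rightarrow> bool" where
  "trajectory S V C \<longleftrightarrow> (\<exists>I \<alpha>. integral_curve S V I \<alpha> \<and>
     (\<forall>J \<beta>. integral_curve S V J \<beta> \<and> I \<subseteq> J \<and> (\<forall>s\<in>I. \<beta> s = \<alpha> s) \<longrightarrow> J = I) \<and> C = \<alpha> ` I)"


section \<open>Hypersurfaces of the product of a sphere and the line\<close>

definition sphere_line :: "('a::euclidean_space \<times> real) set" where
  "sphere_line = sphere 0 1 \<times> UNIV"

definition sphere_slice :: "real \<Rightarrow> ('a::euclidean_space \<times> real) set" where
  "sphere_slice t = sphere 0 1 \<times> {t}"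

definition vertical_field :: "'a::euclidean_space \<times> real" where
  "vertical_field = (0, 1)"

definition height_gradient ::
  "('a::euclidean_space \<times> real) set \<Rightarrow> 'a \<times> real \<Rightarrow> 'a \<times> real" where
  "height_gradient S = gradient_on S snd"

definition angle_fun ::
  "('a::euclidean_space \<times> real \<Rightarrow> 'a \<times> real) \<Rightarrow> 'a \<times> real \<Rightarrow> real" where
  "angle_fun N p = N p \<bullet> vertical_field"

definition horizontal_point :: "('a::euclidean_space \<times> real) set \<Rightarrow> 'a \<times> real \<Rightarrow> bool" where
  "horizontal_point S p \<longleftrightarrow> p \<in> S \<and> height_gradient S p = 0"

text \<open>\<open>S \<inter> sphere_slice t\<close> is a horizontal section: the intersection is nonempty and transversal.\<close>

definition horizontal_section :: "('a::euclidean_space \<times> real) set \<Rightarrow> real \<Rightarrow> bool" where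
  "horizontal_section S t \<longleftrightarrow> S \<inter> sphere_slice t \<noteq> {} \<and>
     (\<forall>p \<in> S \<inter> sphere_slice t.
        {v + w |v w. v \<in> tangent_space S p \<and> w \<in> tangent_space (sphere_slice t) p} =
        tangent_space sphere_line p)"

definition section_normal ::
  "('a::euclidean_space \<times> real \<Rightarrow> 'a \<times> real) \<Rightarrow> 'a \<times> real \<Rightarrow> 'a \<times> real" where
  "section_normal N p =
     - ((1 / sqrt (1 - (angle_fun N p)\<^sup>2)) *\<^sub>R (N p - angle_fun N p *\<^sub>R vertical_field))"

definition section_mean_curvature ::
  "('a::euclidean_space \<times> real) set \<Rightarrow> ('a \<times> real \<Rightarrow> 'a \<times> real) \<Rightarrow> 'a \<times> real \<Rightarrow> real" where
  "section_mean_curvature S N p =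
     mean_curvature (sphere_slice (snd p)) (S \<inter> sphere_slice (snd p)) (section_normal N) p"

text \<open>
  In a vertical catenoid the principal curvature \<open>k\<close> of the height gradient and the mean curvatures
  of the sections are nonzero. With \<open>Z = {}\<close> the next definition demands this everywhere. That
  excludes every surface whose height trajectories are unduloids: if such a trajectory is
  parametrized by the height, the derivative of the angle function along it is \<open>-k\<close>, whereas the
  square of the angle function along it is periodic, so \<open>k\<close> has zeros. (On a rotational surface
  they lie on the sections that are great spheres, where the mean curvature of the section
  vanishes too.) Hence nonzero is understood away from a locally finite set \<open>Z\<close> of heights.
\<close>

definition vertical_catenoid_off ::
  "real set \<Rightarrow> ('a::euclidean_space \<times> real) set \<Rightarrow> bool" where
  "vertical_catenoid_off Z S \<longleftrightarrow> hypersurface sphere_line S \<and>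
     (\<exists>N k. unit_normal sphere_line S N \<and>
        \<not> (\<exists>p. horizontal_point S p) \<and>
        \<not> angle_fun N constant_on S \<and>
        (\<forall>p\<in>S. shape_operator sphere_line S N p (height_gradient S p) = k p *\<^sub>R height_gradient S p \<and>
                (snd p \<notin> Z \<longrightarrow> k p \<noteq> 0)) \<and>
        (\<forall>t. horizontal_section S t \<longrightarrow>
           (\<exists>h. (t \<notin> Z \<longrightarrow> h \<noteq> 0) \<and>
              (\<forall>p \<in> S \<inter> sphere_slice t. section_mean_curvature S N p = h \<and>
                  h = k p / sqrt (1 - (angle_fun N p)\<^sup>2)))))"

definition vertical_catenoid :: "('a::euclidean_space \<times> real) set \<Rightarrow> bool" where
  "vertical_catenoid S \<longleftrightarrow>
     (\<exists>Z. (\<forall>a b. finite (Z \<inter> {a..b})) \<and> vertical_catenoid_off Z S)"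

text \<open>The intrinsic distance of the unit sphere is the angle between two points.\<close>

definition geodesic_sphere :: "'a::euclidean_space \<Rightarrow> real \<Rightarrow> 'a set" where
  "geodesic_sphere c R = {x \<in> sphere 0 1. arccos (c \<bullet> x) = R}"

definition rotational_about :: "'a::euclidean_space \<Rightarrow> ('a \<times> real) set \<Rightarrow> bool" where
  "rotational_about c S \<longleftrightarrow> c \<in> sphere 0 1 \<and>
     (\<forall>t. horizontal_section S t \<longrightarrow>
        (\<exists>R. 0 < R \<and> R < pi \<and> S \<inter> sphere_slice t \<subseteq> geodesic_sphere c R \<times> {t}))"

definition vertically_periodic :: "('a::euclidean_space \<times> real) set \<Rightarrow> bool" where
  "vertically_periodic S \<longleftrightarrow> (\<exists>T. T \<noteq> 0 \<and> (\<lambda>(x, t). (x, t + T)) ` S = S)"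

definition unduloid :: "'a::euclidean_space \<Rightarrow> ('a \<times> real) set \<Rightarrow> bool" where
  "unduloid c C \<longleftrightarrow> (\<exists>\<gamma> \<rho>. unit_speed_geodesic (sphere 0 1) \<gamma> \<and> \<gamma> 0 = c \<and>
     smooth_on UNIV \<rho> \<and> \<not> \<rho> constant_on UNIV \<and> (\<exists>P>0. \<forall>t. \<rho> (t + P) = \<rho> t) \<and>
     (\<exists>a b. 0 < a \<and> a \<le> b \<and> b < pi \<and> range \<rho> \<subseteq> {a..b}) \<and>
     C = range (\<lambda>t. (\<gamma> (\<rho> t), t)))"

end

theory Submission
  imports Defs
begin

text \<open>
  A rotational hypersurface about the axis through a pole \<open>c\<close> is \<open>{(x, t). x \<bullet> c = w t}\<close> with
  \<open>w = cos \<circ> \<rho>\<close>. The height gradient is always a principal direction, and condition (ii) on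
  vertical catenoids becomes \<open>\<rho>'' = (n - 1) cot \<rho> (1 + \<rho>'\<^sup>2)\<close>, with the first integral
  \<open>1 + \<rho>'\<^sup>2 = (sin \<rho> / sin r)^(2 (n - 1))\<close>, where \<open>r\<close> is the minimal radius. Hence \<open>\<rho>\<close> oscillates
  between \<open>r\<close> and \<open>\<pi> - r\<close>. A periodic solution on the whole line is obtained without general theory
  of differential equations: after the substitution \<open>cos \<rho> = cos r * sin \<phi>\<close> the first integral is
  \<open>\<phi>' = g \<phi>\<close> with \<open>g\<close> smooth, positive and \<open>2 \<pi>\<close>-periodic, which is solved by inverting
  an antiderivative of \<open>1 / g\<close>. The height along a trajectory of the height gradient solves an equation of
  the same kind, while the direction from the axis is constant.
\<close>

section \<open>Smooth maps\<close>

text \<open>Taking \<open>w = cos \<circ> \<rho>\<close> as the datum makes the hypersurface a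
  global level set of the smooth function \<open>fst p \<bullet> c - w (snd p)\<close>, and its
  geometry becomes algebra in \<open>w\<close>, \<open>w'\<close>, \<open>w''\<close>. The equation
  for \<open>\<rho>\<close> turns into \<open>w'' (1 - w\<^sup>2) + w w'\<^sup>2 = - (n - 1) w (1 -
  w\<^sup>2 + w'\<^sup>2)\<close>. Its first integral arises from the factor
  \<open>2 \<rho>' / (1 + \<rho>'\<^sup>2)\<close>, which makes both sides logarithmic derivatives.
  The obstacle is the turning points. There the first integral gives \<open>\<rho>'\<close> as a
  vanishing square root, which is not Lipschitz; the constant \<open>\<rho> = r\<close> satisfies it
  as well, although it violates the second order equation because \<open>cot r > 0\<close>. In the
  variable \<open>\<phi>\<close> these points are ordinary, the passage through them is forced, and
  the second order equation holds there too. The heights exempted in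
  \<open>vertical_catenoid\<close> are the zeros of \<open>w\<close>, where \<open>\<phi>\<close> is
  a multiple of \<open>\<pi>\<close>.\<close>

lemma Ck_on_Suc_imp: "Ck_on (Suc k) U f \<Longrightarrow> Ck_on k U f"
proof (induction k arbitrary: f)
  case 0
  then show ?case
    by (auto intro!: continuous_at_imp_continuous_on intro: has_derivative_continuous)
next
  case (Suc k)
  obtain f' where "\<forall>x\<in>U. (f has_derivative f' x) (at x)" "\<forall>v. Ck_on (Suc k) U (\<lambda>x. f' x v)"
    using Suc.prems by (subst (asm) Ck_on.simps(2)) blast
  then show ?case using Suc.IH unfolding Ck_on.simps(2)[of k] by blast
qed

lemma Ck_on_const: "Ck_on k U (\<lambda>x. a)"
proof (induction k arbitrary: a)
  case (Suc k)
  show ?case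
    unfolding Ck_on.simps by (rule exI[of _ "\<lambda>x v. 0"]) (auto simp: Suc)
qed simp

lemma Ck_on_bounded_linear_compose:
  assumes h: "bounded_linear h"
  shows "Ck_on k U f \<Longrightarrow> Ck_on k U (\<lambda>x. h (f x))"
proof (induction k arbitrary: f)
  case 0
  then show ?case using bounded_linear.continuous_on[OF h] by simp
next
  case (Suc k)
  then obtain f' where "\<forall>x\<in>U. (f has_derivative f' x) (at x)" "\<forall>v. Ck_on k U (\<lambda>x. f' x v)"
    by auto
  then show ?case
    unfolding Ck_on.simps using Suc.IH bounded_linear.has_derivative[OF h]
    by (intro exI[of _ "\<lambda>x v. h (f' x v)"]) blast
qed

lemma Ck_on_bounded_linear:
  assumes "bounded_linear h"
  shows "Ck_on k U h"
proof (cases k)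
  case 0
  then show ?thesis using assms by (simp add: linear_continuous_on)
next
  case (Suc j)
  then show ?thesis
    using bounded_linear_imp_has_derivative[OF assms]
    by (auto intro!: exI[of _ "\<lambda>x. h"] Ck_on_const)
qed

lemma Ck_on_add: "Ck_on k U f \<Longrightarrow> Ck_on k U g \<Longrightarrow> Ck_on k U (\<lambda>x. f x + g x)"
proof (induction k arbitrary: f g)
  case 0
  then show ?case by (simp add: continuous_on_add)
next
  case (Suc k)
  obtain f' g' where "\<forall>x\<in>U. (f has_derivative f' x) (at x)" "\<forall>v. Ck_on k U (\<lambda>x. f' x v)"
      "\<forall>x\<in>U. (g has_derivative g' x) (at x)" "\<forall>v. Ck_on k U (\<lambda>x. g' x v)"
    using Suc.prems by auto
  then show ?case
    unfolding Ck_on.simps using Suc.IH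
    by (intro exI[of _ "\<lambda>x v. f' x v + g' x v"]) (blast intro: has_derivative_add)
qed

lemma Ck_on_minus: "Ck_on k U f \<Longrightarrow> Ck_on k U (\<lambda>x. - f x)"
  by (rule Ck_on_bounded_linear_compose[OF bounded_linear_minus[OF bounded_linear_ident]])

lemma Ck_on_diff: "Ck_on k U f \<Longrightarrow> Ck_on k U g \<Longrightarrow> Ck_on k U (\<lambda>x. f x - g x)"
  using Ck_on_add[OF _ Ck_on_minus] by fastforce

text \<open>The product rule leaves one factor undifferentiated in each summand;
  \<open>Ck_on_Suc_imp\<close> lowers its order so that the induction hypothesis applies to both
  summands.\<close>

lemma Ck_on_bounded_bilinear:
  assumes h: "bounded_bilinear h"
  shows "Ck_on k U f \<Longrightarrow> Ck_on k U g \<Longrightarrow> Ck_on k U (\<lambda>x. h (f x) (g x))"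
proof (induction k arbitrary: f g)
  case 0
  then show ?case using bounded_bilinear.continuous_on[OF h] by simp
next
  case (Suc k)
  obtain f' g' where *: "\<forall>x\<in>U. (f has_derivative f' x) (at x)" "\<forall>v. Ck_on k U (\<lambda>x. f' x v)"
      "\<forall>x\<in>U. (g has_derivative g' x) (at x)" "\<forall>v. Ck_on k U (\<lambda>x. g' x v)"
    using Suc.prems by auto
  have "Ck_on k U (\<lambda>x. h (f x) (g' x v) + h (f' x v) (g x))" for v
    using * Suc.prems[THEN Ck_on_Suc_imp] by (intro Ck_on_add Suc.IH) simp_all
  moreover have "((\<lambda>x. h (f x) (g x)) has_derivative (\<lambda>v. h (f x) (g' x v) + h (f' x v) (g x))) (at x)"
    if "x \<in> U" for x
    using * that by (intro bounded_bilinear.FDERIV[OF h]) simp_all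
  ultimately show ?case
    unfolding Ck_on.simps by (intro exI[of _ "\<lambda>x v. h (f x) (g' x v) + h (f' x v) (g x)"]) simp
qed

lemmas Ck_on_scaleR = Ck_on_bounded_bilinear[OF bounded_bilinear_scaleR]
lemmas Ck_on_mult = Ck_on_bounded_bilinear[OF bounded_bilinear_mult]

lemma Ck_on_power: "Ck_on k U f \<Longrightarrow> Ck_on k U (\<lambda>x. f x ^ j)" for f :: "'a::euclidean_space \<Rightarrow> real"
  by (induction j) (auto intro: Ck_on_const Ck_on_mult simp del: Ck_on.simps)

lemma Ck_on_sum: "finite A \<Longrightarrow> (\<And>i. i \<in> A \<Longrightarrow> Ck_on k U (f i)) \<Longrightarrow> Ck_on k U (\<lambda>x. \<Sum>i\<in>A. f i x)"
  by (induction A rule: finite_induct) (auto intro: Ck_on_const Ck_on_add simp del: Ck_on.simps)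

lemma Ck_on_Pair:
  fixes f :: "'a::euclidean_space \<Rightarrow> 'b::euclidean_space" and g :: "'a \<Rightarrow> 'c::euclidean_space"
  assumes "Ck_on k U f" "Ck_on k U g"
  shows "Ck_on k U (\<lambda>x. (f x, g x))"
proof -
  have "bounded_linear (\<lambda>x::'b. (x, 0::'c))" "bounded_linear (\<lambda>x::'c. (0::'b, x))"
    by (auto intro!: bounded_linear_Pair bounded_linear_ident bounded_linear_zero)
  from Ck_on_add[OF Ck_on_bounded_linear_compose[OF this(1) assms(1)]
      Ck_on_bounded_linear_compose[OF this(2) assms(2)]]
  show ?thesis by simp
qed

text \<open>An inner function with real values suffices here, and for it the chain rule only involves the
  product with a scalar.\<close>

lemma Ck_on_compose:
  fixes f :: "'a::euclidean_space \<Rightarrow> real" and h :: "real \<Rightarrow> 'b::euclidean_space"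
  shows "Ck_on k V h \<Longrightarrow> Ck_on k U f \<Longrightarrow> f ` U \<subseteq> V \<Longrightarrow> Ck_on k U (\<lambda>x. h (f x))"
proof (induction k arbitrary: f h)
  case 0
  then show ?case by (auto intro: continuous_on_compose2)
next
  case (Suc k)
  obtain f' h' where *: "\<forall>x\<in>U. (f has_derivative f' x) (at x)" "\<forall>v. Ck_on k U (\<lambda>x. f' x v)"
      "\<forall>y\<in>V. (h has_derivative h' y) (at y)" "\<forall>v. Ck_on k V (\<lambda>y. h' y v)"
    using Suc.prems by auto
  have "((\<lambda>x. h (f x)) has_derivative (\<lambda>v. f' x v *\<^sub>R h' (f x) 1)) (at x)" if "x \<in> U" for x
  proof -
    have h: "(h has_derivative h' (f x)) (at (f x))"
      using * that Suc.prems(3) by blast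
    have "h' (f x) (f' x v) = f' x v *\<^sub>R h' (f x) 1" for v
      using linear_scale[OF has_derivative_linear[OF h], of "f' x v" 1] by simp
    then show ?thesis
      using diff_chain_at[of f "f' x" x h "h' (f x)"] h * that by (simp add: o_def)
  qed
  moreover have "Ck_on k U (\<lambda>x. h' (f x) 1)"
    using Suc.IH[of "\<lambda>y. h' y 1" f] * Suc.prems Ck_on_Suc_imp by blast
  then have "Ck_on k U (\<lambda>x. f' x v *\<^sub>R h' (f x) 1)" for v
    using * by (intro Ck_on_scaleR) simp_all
  ultimately show ?case
    unfolding Ck_on.simps by (intro exI[of _ "\<lambda>x v. f' x v *\<^sub>R h' (f x) 1"]) simp
qed

lemma Ck_on_SucI:
  fixes f :: "real \<Rightarrow> 'b::euclidean_space"
  assumes "\<And>x. x \<in> U \<Longrightarrow> (f has_vector_derivative f' x) (at x)" "Ck_on k U f'"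
  shows "Ck_on (Suc k) U f"
proof -
  have "Ck_on k U (\<lambda>x. v *\<^sub>R f' x)" for v
    using assms(2) by (intro Ck_on_scaleR Ck_on_const)
  then show ?thesis
    unfolding Ck_on.simps using assms(1)
    by (intro exI[of _ "\<lambda>x v. v *\<^sub>R f' x"]) (simp add: has_vector_derivative_def)
qed

text \<open>The derivative in \<open>Ck_on\<close> is existentially quantified. Uniqueness
  identifies its value at 1 with \<open>f'\<close>, and openness of \<open>U\<close> transports
  regularity along an equality that holds on \<open>U\<close> only.\<close>

lemma Ck_on_SucD:
  fixes f :: "real \<Rightarrow> 'b::euclidean_space"
  assumes "Ck_on (Suc k) U f" "open U" "\<And>x. x \<in> U \<Longrightarrow> (f has_vector_derivative f' x) (at x)"
  shows "Ck_on k U f'"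
proof -
  obtain g where g: "\<forall>x\<in>U. (f has_derivative g x) (at x)" "\<forall>v. Ck_on k U (\<lambda>x. g x v)"
    using assms(1) by auto
  have eq: "g x 1 = f' x" if "x \<in> U" for x
  proof -
    have "g x = (\<lambda>v. v *\<^sub>R f' x)"
      using g(1) assms(3) that has_derivative_unique unfolding has_vector_derivative_def by blast
    then show ?thesis by simp
  qed
  have cong: "Ck_on j U h" if "Ck_on j U h0" "\<forall>x\<in>U. h x = h0 x" for j and h h0 :: "real \<Rightarrow> 'b"
  proof (cases j)
    case 0
    then show ?thesis using that by (simp cong: continuous_on_cong)
  next
    case (Suc i)
    then show ?thesis
      using that has_derivative_transform_within_open[OF _ \<open>open U\<close>, of h0 _ _ UNIV h]
      unfolding Suc Ck_on.simps(2)[of i] by metis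
  qed
  show ?thesis by (rule cong[of k "\<lambda>x. g x 1"]) (use g eq in auto)
qed

section \<open>Smooth functions on open sets\<close>

abbreviation Cinf_on :: "'a::euclidean_space set \<Rightarrow> ('a \<Rightarrow> 'b::euclidean_space) \<Rightarrow> bool" where
  "Cinf_on U f \<equiv> \<forall>k. Ck_on k U f"

text \<open>The maps below are smooth on an open superset, mostly the whole space, and so serve as
  their own local extensions.\<close>

lemma smooth_onI: "Cinf_on U f \<Longrightarrow> open U \<Longrightarrow> S \<subseteq> U \<Longrightarrow> smooth_on S f"
  unfolding smooth_on_def by blast

text \<open>A bootstrap: the derivative is expressed through the function itself, so order
  \<open>k\<close> of the function yields order \<open>k\<close> of its derivative.
  \<open>sqrt\<close>, the pair \<open>sin\<close> and \<open>cos\<close>, and solutions of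
  autonomous equations are treated alike.\<close>

lemma Cinf_on_inverse: "Cinf_on {0<..} (inverse :: real \<Rightarrow> real)"
proof
  fix k
  show "Ck_on k {0<..} (inverse :: real \<Rightarrow> real)"
  proof (induction k)
    case 0
    then show ?case by (auto intro!: continuous_intros)
  next
    case (Suc k)
    show ?case
    proof (rule Ck_on_SucI)
      fix x :: real assume "x \<in> {0<..}"
      then show "(inverse has_vector_derivative - (inverse x * inverse x)) (at x)"
        by (auto intro!: derivative_eq_intros simp: has_real_derivative_iff_has_vector_derivative[symmetric])
    qed (intro Ck_on_minus Ck_on_mult Suc)
  qed
qed

lemma Cinf_on_sqrt: "Cinf_on {0<..} sqrt"
proof
  fix k
  show "Ck_on k {0<..} sqrt"
  proof (induction k)
    case 0
    then show ?case by (auto intro!: continuous_intros)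
  next
    case (Suc k)
    have "Ck_on k {0<..} (\<lambda>x. inverse (sqrt x) / 2)"
      by (intro Ck_on_bounded_linear_compose[OF bounded_linear_divide]
            Ck_on_compose[OF Cinf_on_inverse[rule_format] Suc]) auto
    then show ?case
      by (rule Ck_on_SucI[rotated])
         (auto intro!: derivative_eq_intros simp: has_real_derivative_iff_has_vector_derivative[symmetric])
  qed
qed

lemma Cinf_on_sin: "Cinf_on U (sin :: real \<Rightarrow> real)"
  and Cinf_on_cos: "Cinf_on U (cos :: real \<Rightarrow> real)"
proof -
  have "Ck_on k U (sin :: real \<Rightarrow> real) \<and> Ck_on k U (cos :: real \<Rightarrow> real)" for k
  proof (induction k)
    case 0
    then show ?case by (auto intro!: continuous_intros)
  next
    case (Suc k)
    have "Ck_on (Suc k) U (sin :: real \<Rightarrow> real)"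
      by (rule Ck_on_SucI[of _ _ cos])
         (auto intro!: derivative_eq_intros Suc[THEN conjunct2] simp: has_real_derivative_iff_has_vector_derivative[symmetric])
    moreover have "Ck_on (Suc k) U (cos :: real \<Rightarrow> real)"
      by (rule Ck_on_SucI[of _ _ "\<lambda>x. - sin x"])
         (auto intro!: derivative_eq_intros Ck_on_minus Suc[THEN conjunct1]
            simp: has_real_derivative_iff_has_vector_derivative[symmetric])
    ultimately show ?case ..
  qed
  then show "Cinf_on U (sin :: real \<Rightarrow> real)" "Cinf_on U (cos :: real \<Rightarrow> real)" by auto
qed

text \<open>The derivative is composed of \<open>inverse\<close> and \<open>sqrt\<close>, already
  known to be smooth, so a single differentiation settles every order.\<close>

lemma Cinf_on_arccos: "Cinf_on {-1<..<1} arccos"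
proof
  fix k
  show "Ck_on k {-1<..<1} arccos"
  proof (cases k)
    case 0
    have "continuous_on {-1<..<1} arccos"
      using continuous_on_arccos'[THEN continuous_on_subset, of "{-1<..<1}"] by force
    with 0 show ?thesis by simp
  next
    case (Suc j)
    have pos: "1 - x * x > 0" if "x \<in> {-1<..<1}" for x :: real
      using that abs_square_less_1[of x] by (auto simp: power2_eq_square abs_if split: if_splits)
    have "Ck_on j {-1<..<1} (\<lambda>x::real. 1 - x * x)"
      by (intro Ck_on_diff Ck_on_const Ck_on_mult Ck_on_bounded_linear bounded_linear_ident)
    then have "Ck_on j {-1<..<1} (\<lambda>x. sqrt (1 - x * x))"
      using pos by (intro Ck_on_compose[OF Cinf_on_sqrt[rule_format]]) auto
    then have "Ck_on j {-1<..<1} (\<lambda>x. - inverse (sqrt (1 - x * x)))"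
      using pos by (intro Ck_on_minus Ck_on_compose[OF Cinf_on_inverse[rule_format]]) auto
    then have "Ck_on (Suc j) {-1<..<1} arccos"
      by (rule Ck_on_SucI[rotated])
         (auto intro!: derivative_eq_intros
            simp: has_real_derivative_iff_has_vector_derivative[symmetric] power2_eq_square)
    with Suc show ?thesis by simp
  qed
qed

lemma Cinf_on_autonomous_ode:
  assumes "\<And>x::real. (\<phi> has_real_derivative g (\<phi> x)) (at x)" "Cinf_on UNIV g"
  shows "Cinf_on UNIV \<phi>"
proof
  fix k
  show "Ck_on k UNIV \<phi>"
  proof (induction k)
    case 0
    then show ?case using assms(1) by (auto intro!: continuous_at_imp_continuous_on DERIV_isCont)
  next
    case (Suc k)
    have "Ck_on k UNIV (\<lambda>x. g (\<phi> x))"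
      using Ck_on_compose[OF assms(2)[rule_format] Suc] by simp
    then show ?case
      by (rule Ck_on_SucI[rotated])
         (use assms(1) in \<open>auto simp: has_real_derivative_iff_has_vector_derivative\<close>)
  qed
qed

section \<open>Scalar autonomous equations\<close>

text \<open>\<open>G\<close> is the time map, an antiderivative of \<open>1 / g\<close>; the upper bound on \<open>g\<close> makes it
  surjective.\<close>

lemma autonomous_ode:
  fixes g :: "real \<Rightarrow> real"
  assumes cont: "continuous_on UNIV g" and pos: "\<And>x. 0 < g x" and bound: "\<And>x. g x \<le> b"
  obtains G \<phi> where "G 0 = 0" "\<And>x. (G has_real_derivative 1 / g x) (at x)"
    "\<And>x. \<phi> (G x) = x" "\<And>t. G (\<phi> t) = t" "\<And>t. (\<phi> has_real_derivative g (\<phi> t)) (at t)"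
proof -
  have b: "b > 0" using pos[of 0] bound[of 0] by linarith
  have "\<exists>F. \<forall>x. -\<infinity> < ereal x \<longrightarrow> ereal x < \<infinity> \<longrightarrow> (F has_vector_derivative 1 / g x) (at x)"
  proof (rule einterval_antiderivative)
    show "isCont (\<lambda>x. 1 / g x) x" for x
      using cont pos[of x] by (auto intro!: continuous_intros simp: continuous_on_eq_continuous_at)
  qed simp
  then obtain F where F: "\<And>x. (F has_real_derivative 1 / g x) (at x)"
    by (auto simp: has_real_derivative_iff_has_vector_derivative)
  define G where "G x = F x - F 0" for x
  have G: "(G has_real_derivative 1 / g x) (at x)" for x
    unfolding G_def using F[of x] by (auto intro!: derivative_eq_intros)
  have low: "(y - x) / b \<le> G y - G x" if xy: "x < y" for x y
  proof -
    obtain z where z: "G y - G x = (y - x) * (1 / g z)"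
      using MVT2[OF xy G] by blast
    have "1 / b \<le> 1 / g z" using pos[of z] bound[of z] b by (simp add: frac_le)
    then have "(y - x) * (1 / b) \<le> (y - x) * (1 / g z)" using xy by (intro mult_left_mono) auto
    then show ?thesis using z by simp
  qed
  have less: "G x < G y" if "x < y" for x y
    using low[OF that] that b by (smt (verit) divide_pos_pos)
  have "inj G" by (metis injI less less_irrefl linorder_neqE_linordered_idom)
  have "\<exists>x. G x = t" for t
  proof -
    \<comment> \<open>Since \<open>G 0 = 0\<close> and \<open>G\<close> gains at least
      \<open>1 / b\<close> per unit length by \<open>low\<close>, the endpoints \<open>u\<close> and
      \<open>-u\<close> push \<open>G\<close> beyond \<open>\<bar>t\<bar> + 1\<close> in both
      directions.\<close>
    define u where "u = b * (\<bar>t\<bar> + 1)"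
    have u: "u > 0" unfolding u_def using b by simp
    have "G u \<ge> \<bar>t\<bar> + 1" "G (-u) \<le> - (\<bar>t\<bar> + 1)"
      using low[of 0 u] low[of "-u" 0] u b by (auto simp: u_def G_def)
    then have "\<exists>x\<ge>-u. x \<le> u \<and> G x = t"
      using u by (intro IVT') (auto intro!: continuous_at_imp_continuous_on DERIV_isCont G)
    then show ?thesis by blast
  qed
  then have "surj G" by (metis surjI)
  define \<phi> where "\<phi> = inv G"
  have inv1: "\<phi> (G x) = x" for x using \<open>inj G\<close> by (simp add: \<phi>_def)
  have inv2: "G (\<phi> t) = t" for t using \<open>surj G\<close> by (simp add: \<phi>_def surj_f_inv_f)
  \<comment> \<open>The lower bound on the slope of \<open>G\<close> is a Lipschitz bound for its
    inverse; it supplies the continuity that the derivative rule for inverse functions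
    demands.\<close>
  have lip: "\<bar>\<phi> s - \<phi> t\<bar> \<le> b * \<bar>s - t\<bar>" for s t
  proof -
    have *: "\<bar>y - x\<bar> \<le> b * \<bar>G y - G x\<bar>" for x y
    proof -
      have "\<bar>y - x\<bar> / b \<le> \<bar>G y - G x\<bar>"
        using low[of x y] low[of y x] by (cases x y rule: linorder_cases) auto
      then show ?thesis using b by (simp add: field_simps)
    qed
    show ?thesis using *[of "\<phi> s" "\<phi> t"] by (simp add: inv2)
  qed
  have "isCont \<phi> t" for t
  proof -
    have "((\<lambda>s. b * \<bar>s - t\<bar>) \<longlongrightarrow> b * \<bar>t - t\<bar>) (at t)"
      by (intro tendsto_intros)
    then have "((\<lambda>s. \<phi> s - \<phi> t) \<longlongrightarrow> 0) (at t)"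
      by (intro Lim_null_comparison[of "\<lambda>s. \<phi> s - \<phi> t"]) (auto intro!: always_eventually lip)
    then show ?thesis by (simp add: isCont_def LIM_zero_iff)
  qed
  then have "(\<phi> has_real_derivative inverse (1 / g (\<phi> t))) (at t)" for t
    using G[of "\<phi> t"] pos[of "\<phi> t"] inv2
    by (intro DERIV_inverse_function[where f = G and a = "t - 1" and b = "t + 1"]) auto
  then show ?thesis
    using that[of G \<phi>] G inv1 inv2 by (simp add: G_def)
qed

section \<open>Submanifolds of Euclidean space\<close>

lemma tangent_vectorI:
  assumes "Cinf_on UNIV \<kappa>" "range \<kappa> \<subseteq> S" "\<kappa> 0 = p" "(\<kappa> has_vector_derivative v) (at 0)"
  shows "v \<in> tangent_space S p"
  unfolding tangent_space_def using assms
  by (intro CollectI exI[of _ \<kappa>] exI[of _ 1]) (auto intro: smooth_onI[OF assms(1)])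

lemma tangent_space_mono: "S \<subseteq> T \<Longrightarrow> tangent_space S p \<subseteq> tangent_space T p"
  unfolding tangent_space_def by blast

text \<open>Composing with a curve in \<open>S\<close> of velocity \<open>v\<close> reduces the
  claim to uniqueness of derivatives in one variable. It is also how equations for tangent vectors
  are found: a function with two descriptions on \<open>S\<close> has two derivatives there, which
  must agree at \<open>v\<close>.\<close>

lemma tangent_derivative_unique:
  assumes "v \<in> tangent_space S p" "(f has_derivative D) (at p within S)"
    "(f has_derivative D') (at p within S)"
  shows "D v = D' v"
proof -
  obtain \<kappa> e where e: "e > 0" "\<kappa> ` {-e<..<e} \<subseteq> S" "\<kappa> 0 = p"
      "(\<kappa> has_derivative (\<lambda>h. h *\<^sub>R v)) (at 0)"
    using assms(1) unfolding tangent_space_def has_vector_derivative_def by blast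
  have at: "at 0 within {-e<..<e} = at (0::real)"
    using e(1) by (intro at_within_open) auto
  have *: "((\<lambda>s. f (\<kappa> s)) has_derivative (\<lambda>h. D0 (h *\<^sub>R v))) (at 0)"
    if "(f has_derivative D0) (at p within S)" for D0
    using diff_chain_within[of \<kappa> "\<lambda>h. h *\<^sub>R v" 0 "{-e<..<e}" f D0] e
      has_derivative_subset[OF that e(2)] by (simp add: o_def at)
  have "(\<lambda>h. D (h *\<^sub>R v)) = (\<lambda>h. D' (h *\<^sub>R v))"
    using has_derivative_unique[OF *[OF assms(2)] *[OF assms(3)]] .
  then show ?thesis by (metis scaleR_one)
qed

text \<open>Within a thin set \<open>frechet_derivative\<close> is an arbitrary choice among several
  derivatives; its value at a tangent vector is nevertheless determined.\<close>

lemma frechet_derivative_tangent: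
  assumes "v \<in> tangent_space S p" "(f has_derivative D) (at p within S)"
  shows "frechet_derivative f (at p within S) v = D v"
  using tangent_derivative_unique[OF assms(1) _ assms(2)] assms(2) frechet_derivative_works
  unfolding differentiable_def by blast

text \<open>Two candidates differ by a vector of \<open>T\<close> that is orthogonal to
  \<open>T\<close>, hence to itself. The gradient is identified by the same argument.\<close>

lemma orth_proj_eqI:
  assumes "subspace T" "y \<in> T" "\<And>u. u \<in> T \<Longrightarrow> (x - y) \<bullet> u = 0"
  shows "orth_proj T x = y"
  unfolding orth_proj_def
proof (rule the_equality)
  fix z assume z: "z \<in> T \<and> (\<forall>u\<in>T. (x - z) \<bullet> u = 0)"
  have "(z - y) \<bullet> (z - y) = (x - y) \<bullet> (z - y) - (x - z) \<bullet> (z - y)"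
    by (simp add: inner_diff_left)
  also have "\<dots> = 0" using z assms subspace_diff[OF assms(1)] by simp
  finally show "z = y" by simp
qed (use assms in auto)

lemma gradient_on_eqI:
  assumes "subspace (tangent_space S p)" "g \<in> tangent_space S p" "(f has_derivative D) (at p within S)"
    "\<And>v. v \<in> tangent_space S p \<Longrightarrow> g \<bullet> v = D v"
  shows "gradient_on S f p = g"
  unfolding gradient_on_def
proof (rule the_equality)
  show "g \<in> tangent_space S p \<and> (\<forall>v\<in>tangent_space S p. g \<bullet> v = frechet_derivative f (at p within S) v)"
    using assms frechet_derivative_tangent[OF _ assms(3)] by simp
next
  fix z assume z: "z \<in> tangent_space S p \<and>
    (\<forall>v\<in>tangent_space S p. z \<bullet> v = frechet_derivative f (at p within S) v)"
  have "z - g \<in> tangent_space S p" using z assms by (simp add: subspace_diff)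
  then have "(z - g) \<bullet> (z - g) = 0"
    using z assms(4) frechet_derivative_tangent[OF _ assms(3)] by (simp add: inner_diff_left)
  then show "z = g" by simp
qed

lemma exists_unit_orthogonal:
  fixes c :: "'a::euclidean_space"
  assumes "DIM('a) \<ge> 2"
  obtains y where "norm y = 1" "y \<bullet> c = 0"
proof -
  have "dim (span {c}) < DIM('a)"
    using dim_le_card[of "{c}" "{c}"] assms by (simp add: span_base)
  then obtain y0 :: 'a where "y0 \<noteq> 0" "\<And>x. x \<in> span {c} \<Longrightarrow> orthogonal y0 x"
    using orthogonal_to_subspace_exists[of "{c}"] by (metis dim_span)
  then show ?thesis
    using that[of "sgn y0"] span_base[of c "{c}"] by (auto simp: norm_sgn sgn_div_norm orthogonal_def)
qed

text \<open>The horizontal sections are umbilic, so only traces of scalar operators occur; such a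
  trace depends on the basis chosen in \<open>trace_on\<close> only through its cardinality.\<close>

lemma trace_on_scaled:
  assumes T: "subspace T" and A: "\<And>v. v \<in> T \<Longrightarrow> A v = a *\<^sub>R v"
  shows "trace_on T A = a * real (dim T)"
proof -
  define B where "B = (SOME B. orthonormal_basis T B)"
  have "\<exists>B. orthonormal_basis T B"
    using orthonormal_basis_subspace[OF T] unfolding orthonormal_basis_def by metis
  then have B: "orthonormal_basis T B" unfolding B_def by (rule someI_ex)
  then have BT: "B \<subseteq> T" and norm: "\<forall>b\<in>B. norm b = 1" and span: "span B = T"
    unfolding orthonormal_basis_def using span_superset by auto
  have "independent B"
    using B norm unfolding orthonormal_basis_def
    by (intro pairwise_orthogonal_independent) auto
  then have card: "card B = dim T" using dim_span_eq_card_independent[of B] span by simp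
  have "trace_on T A = (\<Sum>b\<in>B. A b \<bullet> b)" unfolding trace_on_def B_def ..
  also have "\<dots> = (\<Sum>b\<in>B. a)"
    using A BT norm by (intro sum.cong) (auto simp: dot_square_norm)
  finally show ?thesis using card by simp
qed

text \<open>For \<open>u = 0\<close> this is the constant curve at \<open>y\<close>, since \<open>sgn 0 = 0\<close>.\<close>

definition great_circle :: "'a::euclidean_space \<Rightarrow> 'a \<Rightarrow> real \<Rightarrow> 'a" where
  "great_circle y u s = cos (norm u * s) *\<^sub>R y + sin (norm u * s) *\<^sub>R sgn u"

lemma great_circle_0 [simp]: "great_circle y u 0 = y"
  by (simp add: great_circle_def)

lemma great_circle_derivative: "(great_circle y u has_vector_derivative u) (at 0)"
proof -
  have "(great_circle y u has_vector_derivative (norm u *\<^sub>R sgn u)) (at 0)"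
    unfolding great_circle_def
    by (auto intro!: derivative_eq_intros)
  then show ?thesis by (cases "u = 0") (auto simp: sgn_div_norm)
qed

lemma norm_great_circle:
  assumes "norm y = 1" "u \<bullet> y = 0"
  shows "norm (great_circle y u s) = 1"
proof -
  have y: "y \<bullet> y = 1" using assms by (simp add: dot_square_norm)
  have u: "sgn u \<bullet> y = 0" using assms by (simp add: sgn_div_norm)
  have s: "u \<noteq> 0 \<Longrightarrow> sgn u \<bullet> sgn u = 1" by (simp add: dot_square_norm norm_sgn)
  have "great_circle y u s \<bullet> great_circle y u s =
      (cos (norm u * s))\<^sup>2 + (sin (norm u * s))\<^sup>2 * (sgn u \<bullet> sgn u)"
    using y u inner_commute[of y "sgn u"]
    by (simp add: great_circle_def inner_add_left inner_add_right power2_eq_square)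
  also have "\<dots> = 1" using s by (cases "u = 0") auto
  finally show ?thesis by (simp add: norm_eq_1)
qed

lemma inner_great_circle: "y \<bullet> a = 0 \<Longrightarrow> u \<bullet> a = 0 \<Longrightarrow> great_circle y u s \<bullet> a = 0"
  by (simp add: great_circle_def inner_add_left sgn_div_norm)

lemma Cinf_on_great_circle: "Cinf_on UNIV (great_circle y u)"
  unfolding great_circle_def
  by (intro allI Ck_on_add Ck_on_scaleR Ck_on_const
      Ck_on_compose[OF Cinf_on_sin[of UNIV, rule_format]] Ck_on_compose[OF Cinf_on_cos[of UNIV, rule_format]]
      Ck_on_bounded_linear bounded_linear_mult_right) auto

section \<open>Tangent spaces of the sphere, the product and its slices\<close>

lemma tangent_space_sphere:
  assumes "x \<in> sphere 0 1"
  shows "tangent_space (sphere 0 1) x = {v. v \<bullet> x = 0}"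
proof (intro equalityI subsetI)
  fix v assume v: "v \<in> tangent_space (sphere 0 1) x"
  \<comment> \<open>On the sphere this function is constant, so the zero map is a second derivative
    of it; comparing the two at \<open>v\<close> gives the linear equation. The reverse inclusion
    exhibits a great circle.\<close>
  have D: "((\<lambda>y. y \<bullet> y) has_derivative (\<lambda>u. 2 * (u \<bullet> x))) (at x within sphere 0 1)"
    by (auto intro!: derivative_eq_intros simp: inner_commute)
  have "((\<lambda>y. y \<bullet> y) has_derivative (\<lambda>u. 0)) (at x within sphere 0 1)"
    by (rule has_derivative_transform[OF assms _ has_derivative_const[of 1]])
       (simp add: dot_square_norm)
  from tangent_derivative_unique[OF v D this] show "v \<in> {v. v \<bullet> x = 0}" by simp
next
  fix v assume "v \<in> {v. v \<bullet> x = 0}"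
  then show "v \<in> tangent_space (sphere 0 1) x"
    using assms
    by (intro tangent_vectorI[of "great_circle x v"])
       (auto simp: norm_great_circle intro: Cinf_on_great_circle[rule_format] great_circle_derivative)
qed

lemma tangent_space_sphere_line:
  assumes "p \<in> sphere_line"
  shows "tangent_space sphere_line p = {v. fst v \<bullet> fst p = 0}"
proof (intro equalityI subsetI)
  fix v :: "'a \<times> real" assume v: "v \<in> tangent_space sphere_line p"
  have D: "((\<lambda>y. fst y \<bullet> fst y) has_derivative (\<lambda>u. 2 * (fst u \<bullet> fst p))) (at p within sphere_line)"
    by (auto intro!: derivative_eq_intros simp: inner_commute)
  have "((\<lambda>y. fst y \<bullet> fst y) has_derivative (\<lambda>u. 0)) (at p within sphere_line)"
    by (rule has_derivative_transform[OF assms _ has_derivative_const[of 1]])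
       (auto simp: sphere_line_def dot_square_norm)
  from tangent_derivative_unique[OF v D this] show "v \<in> {v. fst v \<bullet> fst p = 0}" by simp
next
  fix v :: "'a \<times> real" assume "v \<in> {v. fst v \<bullet> fst p = 0}"
  moreover obtain v1 v2 where "v = (v1, v2)" by fastforce
  ultimately show "v \<in> tangent_space sphere_line p"
    using assms
    by (intro tangent_vectorI[of "\<lambda>s. (great_circle (fst p) v1 s, snd p + s * v2)"]
          allI Ck_on_Pair Cinf_on_great_circle[rule_format] Ck_on_add Ck_on_const Ck_on_mult
          Ck_on_bounded_linear bounded_linear_ident)
       (auto simp: sphere_line_def norm_great_circle has_real_derivative_iff_has_vector_derivative[symmetric]
          intro!: derivative_eq_intros great_circle_derivative has_vector_derivative_Pair)
qed

lemma tangent_space_sphere_slice: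
  assumes "p \<in> sphere_slice t"
  shows "tangent_space (sphere_slice t) p = {v. fst v \<bullet> fst p = 0 \<and> snd v = 0}"
proof (intro equalityI subsetI)
  fix v :: "'a \<times> real" assume v: "v \<in> tangent_space (sphere_slice t) p"
  have D: "(snd has_derivative snd) (at p within sphere_slice t)"
    by (auto intro!: derivative_eq_intros)
  have "(snd has_derivative (\<lambda>u. 0)) (at p within sphere_slice t)"
    by (rule has_derivative_transform[OF assms _ has_derivative_const[of t]])
       (auto simp: sphere_slice_def)
  from tangent_derivative_unique[OF v D this] have "snd v = 0" .
  moreover have "fst v \<bullet> fst p = 0"
    using v tangent_space_mono[of "sphere_slice t" sphere_line p] tangent_space_sphere_line[of p] assms
    by (auto simp: sphere_slice_def sphere_line_def)
  ultimately show "v \<in> {v. fst v \<bullet> fst p = 0 \<and> snd v = 0}" by simp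
next
  fix v :: "'a \<times> real" assume "v \<in> {v. fst v \<bullet> fst p = 0 \<and> snd v = 0}"
  moreover obtain v1 v2 where "v = (v1, v2)" by fastforce
  ultimately show "v \<in> tangent_space (sphere_slice t) p"
    using assms
    by (intro tangent_vectorI[of "\<lambda>s. (great_circle (fst p) v1 s, t)"]
          allI Ck_on_Pair Cinf_on_great_circle[rule_format] Ck_on_const)
       (auto simp: sphere_slice_def norm_great_circle
          intro!: great_circle_derivative has_vector_derivative_Pair has_vector_derivative_const)
qed

section \<open>Rotational hypersurfaces\<close>

text \<open>The section of the hypersurface at height \<open>t\<close> is the geodesic sphere of radius
  \<open>arccos (w t)\<close> about \<open>c\<close>.\<close>

locale rotational_graph =
  fixes c :: "'a::euclidean_space" and w w' w'' :: "real \<Rightarrow> real"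
  assumes norm_c: "norm c = 1"
    and Cinf_w: "Cinf_on UNIV w"
    and w': "\<And>t. (w has_real_derivative w' t) (at t)"
    and w'': "\<And>t. (w' has_real_derivative w'' t) (at t)"
    and w_less: "\<And>t. \<bar>w t\<bar> < 1"
begin

section \<open>Polar coordinates about the axis\<close>

definition surf :: "('a \<times> real) set" where
  "surf = {p. norm (fst p) = 1 \<and> fst p \<bullet> c = w (snd p)}"

text \<open>This is \<open>sin \<rho>\<close>, the Euclidean radius of the section.\<close>

definition \<sigma> :: "real \<Rightarrow> real" where "\<sigma> t = sqrt (1 - (w t)\<^sup>2)"

text \<open>Equal to \<open>sin \<rho> * sqrt (1 + \<rho>'\<^sup>2)\<close>; along the surface it is
  the length of the gradient in \<open>sphere_line\<close> of
  \<open>fst p \<bullet> c - w (snd p)\<close>.\<close>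

definition \<delta> :: "real \<Rightarrow> real" where "\<delta> t = sqrt (1 - (w t)\<^sup>2 + (w' t)\<^sup>2)"

text \<open>The normalized gradient of \<open>fst p \<bullet> c - w (snd p)\<close>, by a formula
  that is smooth on the whole space. Its horizontal part points towards \<open>c\<close>, so
  \<open>section_normal\<close> points away from \<open>c\<close>.\<close>

definition normal :: "'a \<times> real \<Rightarrow> 'a \<times> real" where
  "normal p = (inverse (\<delta> (snd p)) *\<^sub>R (c - w (snd p) *\<^sub>R fst p), - (w' (snd p) * inverse (\<delta> (snd p))))"

definition point :: "'a \<Rightarrow> real \<Rightarrow> 'a \<times> real" where
  "point y t = (w t *\<^sub>R c + \<sigma> t *\<^sub>R y, t)"

lemma w_square_less: "(w t)\<^sup>2 < 1"
  using w_less[of t] by (simp add: abs_square_less_1)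

lemma \<sigma>_pos: "\<sigma> t > 0" and \<sigma>_square: "(\<sigma> t)\<^sup>2 = 1 - (w t)\<^sup>2"
  using w_square_less[of t] by (auto simp: \<sigma>_def)

lemma \<delta>_pos: "\<delta> t > 0" and \<delta>_square: "(\<delta> t)\<^sup>2 = (\<sigma> t)\<^sup>2 + (w' t)\<^sup>2"
proof -
  have "1 - (w t)\<^sup>2 + (w' t)\<^sup>2 > 0"
    using w_square_less[of t] zero_le_power2[of "w' t"] by linarith
  then show "\<delta> t > 0" "(\<delta> t)\<^sup>2 = (\<sigma> t)\<^sup>2 + (w' t)\<^sup>2"
    by (auto simp: \<delta>_def \<sigma>_square)
qed

lemma \<sigma>': "(\<sigma> has_real_derivative - w t * w' t / \<sigma> t) (at t)"
  unfolding \<sigma>_def using w_square_less[of t]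
  by (auto intro!: derivative_eq_intros w' simp: field_simps)

lemma \<delta>': "(\<delta> has_real_derivative (w' t * w'' t - w t * w' t) / \<delta> t) (at t)"
proof -
  have "1 - (w t)\<^sup>2 + (w' t)\<^sup>2 > 0"
    using w_square_less[of t] zero_le_power2[of "w' t"] by linarith
  then show ?thesis
    unfolding \<delta>_def by (auto intro!: derivative_eq_intros w' w'' simp: field_simps)
qed

lemma inner_c: "c \<bullet> c = 1"
  using norm_c by (simp add: dot_square_norm)

lemma Cinf_w': "Cinf_on UNIV w'"
proof
  fix k
  show "Ck_on k UNIV w'"
    by (rule Ck_on_SucD[OF Cinf_w[rule_format] open_UNIV])
       (rule w'[unfolded has_real_derivative_iff_has_vector_derivative])
qed

lemma Cinf_\<sigma>: "Cinf_on UNIV \<sigma>"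
proof -
  have "Ck_on k UNIV (\<lambda>t. 1 - w t * w t)" for k
    by (intro Ck_on_diff Ck_on_const Ck_on_mult Cinf_w[rule_format])
  then show ?thesis
    using w_square_less unfolding \<sigma>_def[abs_def] power2_eq_square
    by (intro allI Ck_on_compose[OF Cinf_on_sqrt[rule_format]]) auto
qed

lemma Cinf_inverse_\<delta>: "Cinf_on UNIV (\<lambda>t. inverse (\<delta> t))"
proof -
  have "Ck_on k UNIV (\<lambda>t. 1 - w t * w t + w' t * w' t)" for k
    by (intro Ck_on_add Ck_on_diff Ck_on_const Ck_on_mult Cinf_w[rule_format] Cinf_w'[rule_format])
  moreover have "1 - w t * w t + w' t * w' t > 0" for t
    using w_square_less[of t] zero_le_power2[of "w' t"] unfolding power2_eq_square by linarith
  ultimately have "Ck_on k UNIV \<delta>" for k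
    unfolding \<delta>_def[abs_def] power2_eq_square
    by (intro Ck_on_compose[OF Cinf_on_sqrt[rule_format]]) auto
  then show ?thesis
    using \<delta>_pos by (intro allI Ck_on_compose[OF Cinf_on_inverse[rule_format]]) auto
qed

lemma surf_subset: "surf \<subseteq> sphere_line"
  by (auto simp: surf_def sphere_line_def)

lemma point_in_surf:
  assumes "norm y = 1" "y \<bullet> c = 0"
  shows "point y t \<in> surf"
proof -
  have y: "y \<bullet> y = 1" using assms by (simp add: dot_square_norm)
  have "fst (point y t) \<bullet> fst (point y t) = (w t)\<^sup>2 + (\<sigma> t)\<^sup>2"
    using assms y inner_c inner_commute[of y c]
    by (simp add: point_def inner_add_left inner_add_right power2_eq_square)
  also have "\<dots> = 1" by (simp add: \<sigma>_square)
  finally have "norm (fst (point y t)) = 1" by (simp add: norm_eq_1)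
  then show ?thesis
    using assms inner_c by (simp add: surf_def point_def inner_add_left)
qed

lemma surf_coordinates:
  assumes "p \<in> surf"
  defines "y \<equiv> inverse (\<sigma> (snd p)) *\<^sub>R (fst p - w (snd p) *\<^sub>R c)"
  shows "norm y = 1" "y \<bullet> c = 0" "p = point y (snd p)"
proof -
  let ?t = "snd p"
  have p: "fst p \<bullet> fst p = 1" "fst p \<bullet> c = w ?t" "c \<bullet> fst p = w ?t"
    using assms by (auto simp: surf_def dot_square_norm inner_commute)
  have *: "(fst p - w ?t *\<^sub>R c) \<bullet> (fst p - w ?t *\<^sub>R c) = (\<sigma> ?t)\<^sup>2"
    unfolding \<sigma>_square using p inner_c
    by (simp add: inner_diff_left inner_diff_right power2_eq_square)
  have "y \<bullet> y = inverse (\<sigma> ?t) * (inverse (\<sigma> ?t) * (\<sigma> ?t)\<^sup>2)"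
    unfolding y_def inner_scaleR_left inner_scaleR_right * ..
  also have "\<dots> = 1"
    using \<sigma>_pos[of ?t] by (simp add: power2_eq_square field_simps)
  finally have "y \<bullet> y = 1" .
  then show "norm y = 1" by (simp add: norm_eq_1)
  show "y \<bullet> c = 0" using p inner_c by (simp add: y_def inner_diff_left)
  show "p = point y ?t"
    using \<sigma>_pos[of ?t] by (simp add: point_def y_def prod_eq_iff)
qed

section \<open>Tangent spaces of the hypersurface and of its sections\<close>

lemma tangent_vector_surf:
  assumes y: "norm y = 1" "y \<bullet> c = 0" and u: "u \<bullet> y = 0" "u \<bullet> c = 0"
    and T: "T = surf \<or> b = 0 \<and> T = surf \<inter> sphere_slice t"
  shows "((w' t * b) *\<^sub>R c + (- w t * w' t / \<sigma> t * b) *\<^sub>R y + \<sigma> t *\<^sub>R u, b) \<in> tangent_space T (point y t)"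
proof (rule tangent_vectorI[of "\<lambda>s. point (great_circle y u s) (t + s * b)"])
  have h: "Ck_on k UNIV (\<lambda>s. t + s * b)" for k
    by (intro Ck_on_add Ck_on_const Ck_on_mult Ck_on_bounded_linear bounded_linear_ident)
  show "Cinf_on UNIV (\<lambda>s. point (great_circle y u s) (t + s * b))"
    unfolding point_def
    by (intro allI Ck_on_Pair Ck_on_add[of _ _ "\<lambda>s. w (t + s * b) *\<^sub>R c"] Ck_on_scaleR Ck_on_const h
        Cinf_on_great_circle[rule_format] Ck_on_compose[OF Cinf_w[rule_format] h]
        Ck_on_compose[OF Cinf_\<sigma>[rule_format] h]) auto
  have "point (great_circle y u s) (t + s * b) \<in> surf" for s
    using y u by (intro point_in_surf norm_great_circle inner_great_circle)
  then show "range (\<lambda>s. point (great_circle y u s) (t + s * b)) \<subseteq> T"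
    using T surf_subset by (auto simp: sphere_slice_def sphere_line_def point_def)
  have h': "((\<lambda>s. t + s * b) has_real_derivative b) (at 0)"
    by (auto intro!: derivative_eq_intros)
  have "((\<lambda>s. w (t + s * b)) has_real_derivative w' t * b) (at 0)"
    "((\<lambda>s. \<sigma> (t + s * b)) has_real_derivative - w t * w' t / \<sigma> t * b) (at 0)"
    using DERIV_chain2[OF _ h', of w "w' t"] DERIV_chain2[OF _ h', of \<sigma> "- w t * w' t / \<sigma> t"]
      w'[of t] \<sigma>'[of t] by simp_all
  note D = this
  have D1: "((\<lambda>s. w (t + s * b) *\<^sub>R c) has_vector_derivative (w' t * b) *\<^sub>R c) (at 0)"
    using has_vector_derivative_scaleR[OF D(1) has_vector_derivative_const[of c]] by simp
  have D2: "((\<lambda>s. \<sigma> (t + s * b) *\<^sub>R great_circle y u s) has_vector_derivative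
      (- w t * w' t / \<sigma> t * b) *\<^sub>R y + \<sigma> t *\<^sub>R u) (at 0)"
    using has_vector_derivative_scaleR[OF D(2) great_circle_derivative[of y u]]
    by (simp add: add.commute)
  show "((\<lambda>s. point (great_circle y u s) (t + s * b)) has_vector_derivative
      ((w' t * b) *\<^sub>R c + (- w t * w' t / \<sigma> t * b) *\<^sub>R y + \<sigma> t *\<^sub>R u, b)) (at 0)"
    unfolding point_def add.assoc
    using has_vector_derivative_Pair[OF has_vector_derivative_add[OF D1 D2]
        h'[unfolded has_real_derivative_iff_has_vector_derivative]] by simp
qed (simp add: point_def)

text \<open>As \<open>fst p\<close> is \<open>w c + \<sigma> y\<close> with
  \<open>\<sigma> > 0\<close>, the two linear conditions fix the components of \<open>v1\<close>
  along \<open>c\<close> and \<open>y\<close>; what remains, divided by \<open>\<sigma>\<close>, is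
  \<open>u\<close>.\<close>

lemma tangent_vector_decomposition:
  assumes p: "p \<in> surf" and v: "v1 \<bullet> fst p = 0" "v1 \<bullet> c = w' (snd p) * b"
  obtains y u where "norm y = 1" "y \<bullet> c = 0" "u \<bullet> y = 0" "u \<bullet> c = 0" "p = point y (snd p)"
    "v1 = (w' (snd p) * b) *\<^sub>R c + (- w (snd p) * w' (snd p) / \<sigma> (snd p) * b) *\<^sub>R y + \<sigma> (snd p) *\<^sub>R u"
proof -
  let ?t = "snd p"
  obtain y where y: "norm y = 1" "y \<bullet> c = 0" "p = point y ?t"
    using surf_coordinates[OF p] by blast
  define u where "u = inverse (\<sigma> ?t) *\<^sub>R (v1 - (w' ?t * b) *\<^sub>R c - (- w ?t * w' ?t / \<sigma> ?t * b) *\<^sub>R y)"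
  have yy: "y \<bullet> y = 1" "c \<bullet> y = 0" using y by (auto simp: dot_square_norm inner_commute)
  have "fst p = w ?t *\<^sub>R c + \<sigma> ?t *\<^sub>R y" using y(3) by (metis point_def fst_conv)
  then have "w ?t * (v1 \<bullet> c) + \<sigma> ?t * (v1 \<bullet> y) = 0" using v(1) by (simp add: inner_add_right)
  then have vy: "v1 \<bullet> y = - w ?t * w' ?t / \<sigma> ?t * b"
    using \<sigma>_pos[of ?t] v(2) by (simp add: field_simps)
  have "u \<bullet> y = 0" "u \<bullet> c = 0"
    using vy yy v(2) y(2) inner_c by (simp_all add: u_def inner_diff_left inner_add_left)
  moreover have "v1 = (w' ?t * b) *\<^sub>R c + (- w ?t * w' ?t / \<sigma> ?t * b) *\<^sub>R y + \<sigma> ?t *\<^sub>R u"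
    using \<sigma>_pos[of ?t] by (simp add: u_def)
  ultimately show ?thesis using that y by blast
qed

lemma tangent_space_surf:
  assumes p: "p \<in> surf"
  shows "tangent_space surf p = {v. fst v \<bullet> fst p = 0 \<and> fst v \<bullet> c = w' (snd p) * snd v}"
proof (intro equalityI subsetI)
  fix v :: "'a \<times> real" assume v: "v \<in> tangent_space surf p"
  have D1: "((\<lambda>q. fst q \<bullet> c) has_derivative (\<lambda>u. fst u \<bullet> c)) (at p within surf)"
    by (auto intro!: derivative_eq_intros)
  have "((\<lambda>q. w (snd q)) has_derivative (\<lambda>u. w' (snd p) * snd u)) (at p within surf)"
    by (rule has_derivative_compose[OF has_derivative_snd[OF has_derivative_ident]
          w'[of "snd p", unfolded has_field_derivative_def]])
  then have D2: "((\<lambda>q. fst q \<bullet> c) has_derivative (\<lambda>u. w' (snd p) * snd u)) (at p within surf)"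
    by (rule has_derivative_transform[OF p, rotated]) (simp add: surf_def)
  show "v \<in> {v. fst v \<bullet> fst p = 0 \<and> fst v \<bullet> c = w' (snd p) * snd v}"
    using tangent_derivative_unique[OF v D1 D2] v tangent_space_mono[OF surf_subset, of p]
      tangent_space_sphere_line[of p] p surf_subset by auto
next
  fix v :: "'a \<times> real" assume "v \<in> {v. fst v \<bullet> fst p = 0 \<and> fst v \<bullet> c = w' (snd p) * snd v}"
  then obtain y u where "norm y = 1" "y \<bullet> c = 0" "u \<bullet> y = 0" "u \<bullet> c = 0" "p = point y (snd p)"
    "fst v = (w' (snd p) * snd v) *\<^sub>R c + (- w (snd p) * w' (snd p) / \<sigma> (snd p) * snd v) *\<^sub>R y + \<sigma> (snd p) *\<^sub>R u"
    using tangent_vector_decomposition[OF p] by blast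
  then show "v \<in> tangent_space surf p"
    using tangent_vector_surf[of y u surf "snd v" "snd p"] by (metis prod.collapse)
qed

lemma tangent_space_section:
  assumes p: "p \<in> surf" and t: "t = snd p"
  shows "tangent_space (surf \<inter> sphere_slice t) p = {v. fst v \<bullet> fst p = 0 \<and> fst v \<bullet> c = 0 \<and> snd v = 0}"
proof (intro equalityI subsetI)
  fix v :: "'a \<times> real" assume v: "v \<in> tangent_space (surf \<inter> sphere_slice t) p"
  have "p \<in> sphere_slice t"
    using p surf_subset t by (auto simp: sphere_slice_def sphere_line_def mem_Times_iff)
  moreover have "v \<in> tangent_space surf p" "v \<in> tangent_space (sphere_slice t) p"
    using v tangent_space_mono[of "surf \<inter> sphere_slice t"] by blast+
  ultimately show "v \<in> {v. fst v \<bullet> fst p = 0 \<and> fst v \<bullet> c = 0 \<and> snd v = 0}"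
    using tangent_space_surf[OF p] tangent_space_sphere_slice[of p t] by simp
next
  fix v :: "'a \<times> real" assume v: "v \<in> {v. fst v \<bullet> fst p = 0 \<and> fst v \<bullet> c = 0 \<and> snd v = 0}"
  then obtain y u where "norm y = 1" "y \<bullet> c = 0" "u \<bullet> y = 0" "u \<bullet> c = 0" "p = point y (snd p)"
    "fst v = (w' (snd p) * 0) *\<^sub>R c + (- w (snd p) * w' (snd p) / \<sigma> (snd p) * 0) *\<^sub>R y + \<sigma> (snd p) *\<^sub>R u"
    using tangent_vector_decomposition[OF p, of "fst v" 0] by auto
  then show "v \<in> tangent_space (surf \<inter> sphere_slice t) p"
    using tangent_vector_surf[of y u "surf \<inter> sphere_slice t" 0 "snd p"] v t
    by (metis (mono_tags, lifting) mem_Collect_eq prod.collapse)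
qed

text \<open>The space is the orthogonal complement of three orthonormal vectors in dimension
  \<open>DIM('a) + 1\<close>: since \<open>\<sigma> > 0\<close>, orthogonality to \<open>c\<close>
  and \<open>fst p\<close> amounts to orthogonality to \<open>c\<close> and
  \<open>y\<close>.\<close>

lemma dim_tangent_space_section:
  assumes p: "p \<in> surf" and t: "t = snd p"
  shows "subspace (tangent_space (surf \<inter> sphere_slice t) p)"
    "dim (tangent_space (surf \<inter> sphere_slice t) p) + 2 = DIM('a)"
proof -
  obtain y where y: "norm y = 1" "y \<bullet> c = 0" "p = point y t"
    using surf_coordinates[OF p] t by blast
  have fp: "fst p = w t *\<^sub>R c + \<sigma> t *\<^sub>R y" using y(3) by (simp add: point_def)
  have cy: "c \<bullet> y = 0" using y by (simp add: inner_commute)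
  have yc: "y \<noteq> c" using y inner_c by auto
  let ?B = "{(y, 0), (c, 0), (0, 1)} :: ('a \<times> real) set"
  have "pairwise orthogonal ?B" "0 \<notin> ?B"
    using y cy norm_c by (auto simp: pairwise_def orthogonal_def zero_prod_def)
  then have "independent ?B" by (rule pairwise_orthogonal_independent)
  then have "dim (span ?B) = 3"
    using yc dim_span_eq_card_independent[of ?B] by simp
  moreover have "dim {v \<in> UNIV. \<forall>q\<in>span ?B. orthogonal q v} + dim (span ?B) = dim (UNIV :: ('a \<times> real) set)"
    by (rule dim_subspace_orthogonal_to_vectors) auto
  moreover have "tangent_space (surf \<inter> sphere_slice t) p = {v \<in> UNIV. \<forall>q\<in>span ?B. orthogonal q v}"
  proof -
    have "(\<forall>q\<in>span ?B. orthogonal q v) \<longleftrightarrow> fst v \<bullet> fst p = 0 \<and> fst v \<bullet> c = 0 \<and> snd v = 0" for v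
    proof -
      have "(\<forall>q\<in>span ?B. orthogonal q v) \<longleftrightarrow> (\<forall>q\<in>?B. orthogonal q v)"
        using orthogonal_to_span[of _ ?B v] span_base[of _ ?B] by (metis orthogonal_commute)
      then show ?thesis
        using \<sigma>_pos[of t]
        by (cases v) (auto simp: orthogonal_def fp inner_add_right inner_commute)
    qed
    then show ?thesis unfolding tangent_space_section[OF p t] by simp
  qed
  ultimately show "dim (tangent_space (surf \<inter> sphere_slice t) p) + 2 = DIM('a)" by simp
  show "subspace (tangent_space (surf \<inter> sphere_slice t) p)"
    unfolding tangent_space_section[OF p t] subspace_def by (auto simp: inner_add_left)
qed

lemma fst_point: "fst (point y t) = w t *\<^sub>R c + \<sigma> t *\<^sub>R y" and snd_point [simp]: "snd (point y t) = t"
  by (simp_all add: point_def)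

section \<open>Embedding, unit normal and height gradient\<close>

lemma hypersurface_surf:
  assumes "DIM('a) \<ge> 2"
  shows "hypersurface sphere_line surf"
proof -
  obtain y where "norm y = 1" "y \<bullet> c = 0" using exists_unit_orthogonal[where c = c] assms by blast
  then have "point y 0 \<in> surf" by (rule point_in_surf)
  then have ne: "surf \<noteq> {}" by blast
  let ?f = "\<lambda>q :: 'a \<times> real. fst q \<bullet> c - w (snd q)"
  have w: "Ck_on k UNIV (\<lambda>q :: 'a \<times> real. w (snd q))" for k
    by (intro Ck_on_compose[OF Cinf_w[rule_format]] Ck_on_bounded_linear bounded_linear_snd) simp
  have "Ck_on k UNIV ?f" for k
    by (rule Ck_on_diff[OF _ w])
       (intro Ck_on_bounded_linear bounded_linear_inner_left_comp bounded_linear_fst)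
  then have smooth: "smooth_on UNIV ?f" by (intro smooth_onI[of UNIV]) simp_all
  have f': "frechet_derivative ?f (at q) = (\<lambda>v. fst v \<bullet> c - w' (snd q) * snd v)" for q
  proof (rule frechet_derivative_at[symmetric])
    show "(?f has_derivative (\<lambda>v. fst v \<bullet> c - w' (snd q) * snd v)) (at q)"
      by (auto intro!: derivative_eq_intros has_derivative_compose[OF _ w'[unfolded has_field_derivative_def]])
  qed
  have "\<exists>v\<in>tangent_space sphere_line q. frechet_derivative ?f (at q) v \<noteq> 0" if "q \<in> surf" for q
  \<comment> \<open>The witness is the part of \<open>c\<close> tangent to the sphere; the
    derivative of \<open>?f\<close> along it is \<open>1 - w\<^sup>2 > 0\<close>.\<close>
  proof (rule bexI[of _ "(c - w (snd q) *\<^sub>R fst q, 0)"])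
    have q: "fst q \<bullet> fst q = 1" "fst q \<bullet> c = w (snd q)" "c \<bullet> fst q = w (snd q)"
      using that by (auto simp: surf_def dot_square_norm inner_commute)
    have "w (snd q) * w (snd q) < 1" using w_square_less by (simp add: power2_eq_square)
    then show "frechet_derivative ?f (at q) (c - w (snd q) *\<^sub>R fst q, 0) \<noteq> 0"
      using q inner_c by (simp add: f' inner_diff_left)
    have "q \<in> sphere_line" using that surf_subset by blast
    then show "(c - w (snd q) *\<^sub>R fst q, 0) \<in> tangent_space sphere_line q"
      using q by (simp add: tangent_space_sphere_line inner_diff_left)
  qed
  then show ?thesis
    unfolding hypersurface_def using ne surf_subset smooth
    by (intro conjI ballI exI[of _ UNIV] exI[of _ ?f])
       (auto simp: surf_def sphere_line_def)
qed

lemma properly_embedded_surf: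
  assumes "DIM('a) \<ge> 2"
  shows "properly_embedded sphere_line surf"
proof -
  have "continuous_on UNIV w" by (rule DERIV_continuous_on) (rule w')
  then have "continuous_on UNIV (\<lambda>p :: 'a \<times> real. w (snd p))"
    using continuous_on_compose2[OF _ continuous_on_snd[OF continuous_on_id], of UNIV w UNIV] by simp
  then have "closed surf"
    unfolding surf_def by (intro closed_Collect_conj closed_Collect_eq continuous_intros)
  then show ?thesis
    using hypersurface_surf[OF assms] by (auto simp: properly_embedded_def closed_Int_compact)
qed

lemma unit_normal_surf: "unit_normal sphere_line surf normal"
proof -
  have snd: "Ck_on k UNIV (\<lambda>q :: 'a \<times> real. f (snd q))" if "Cinf_on UNIV f" for k and f :: "real \<Rightarrow> real"
    by (intro Ck_on_compose[OF that[rule_format]] Ck_on_bounded_linear bounded_linear_snd) simp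
  have "Ck_on k UNIV (\<lambda>q :: 'a \<times> real. c - w (snd q) *\<^sub>R fst q)" for k
    by (intro Ck_on_diff Ck_on_const Ck_on_scaleR snd[OF Cinf_w] Ck_on_bounded_linear[OF bounded_linear_fst])
  then have "Ck_on k UNIV normal" for k
    unfolding normal_def[abs_def]
    by (intro Ck_on_Pair Ck_on_minus Ck_on_mult Ck_on_scaleR snd[OF Cinf_w'] snd[OF Cinf_inverse_\<delta>])
  then have smooth: "smooth_on surf normal" by (intro smooth_onI[of UNIV]) simp_all
  have "normal p \<in> tangent_space sphere_line p \<and> norm (normal p) = 1 \<and>
      (\<forall>v\<in>tangent_space surf p. normal p \<bullet> v = 0)" if p: "p \<in> surf" for p
  proof -
    have q: "fst p \<bullet> fst p = 1" "fst p \<bullet> c = w (snd p)" "c \<bullet> fst p = w (snd p)"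
      using p by (auto simp: surf_def dot_square_norm inner_commute)
    have "p \<in> sphere_line" using p surf_subset by blast
    then have "normal p \<in> tangent_space sphere_line p"
      using q by (simp add: tangent_space_sphere_line normal_def inner_diff_left)
    moreover have "normal p \<bullet> normal p = (inverse (\<delta> (snd p)))\<^sup>2 * ((\<sigma> (snd p))\<^sup>2 + (w' (snd p))\<^sup>2)"
      unfolding \<sigma>_square using q inner_c
      by (simp add: normal_def inner_prod_def inner_diff_left inner_diff_right power2_eq_square algebra_simps)
    then have "norm (normal p) = 1"
      unfolding \<delta>_square[symmetric] using \<delta>_pos[of "snd p"] by (simp add: norm_eq_1 power_inverse)
    moreover have "normal p \<bullet> v = 0" if "v \<in> tangent_space surf p" for v
    proof -
      have "fst p \<bullet> fst v = 0" "c \<bullet> fst v = w' (snd p) * snd v"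
        using that by (simp_all add: tangent_space_surf[OF p] inner_commute)
      then show ?thesis by (simp add: normal_def inner_prod_def inner_diff_left)
    qed
    ultimately show ?thesis by blast
  qed
  with smooth show ?thesis unfolding unit_normal_def by blast
qed

lemma angle_fun_normal: "angle_fun normal p = - (w' (snd p) / \<delta> (snd p))"
  by (simp add: angle_fun_def normal_def vertical_field_def divide_inverse)

lemma sqrt_angle_normal: "sqrt (1 - (angle_fun normal p)\<^sup>2) = \<sigma> (snd p) / \<delta> (snd p)"
proof (rule real_sqrt_unique)
  have "(\<delta> (snd p))\<^sup>2 \<noteq> 0" using \<delta>_pos[of "snd p"] by simp
  then show "(\<sigma> (snd p) / \<delta> (snd p))\<^sup>2 = 1 - (angle_fun normal p)\<^sup>2"
    using \<delta>_square[of "snd p"] by (simp add: angle_fun_normal power_divide field_simps)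
qed (use \<sigma>_pos \<delta>_pos in \<open>simp add: less_imp_le\<close>)

text \<open>The gradient is the tangential part of the vertical field,
  \<open>vertical_field - \<Theta> N\<close> with \<open>\<Theta> = - w' / \<delta>\<close>.\<close>

lemma height_gradient_surf:
  assumes p: "p \<in> surf"
  shows "height_gradient surf p = ((w' (snd p) / (\<delta> (snd p))\<^sup>2) *\<^sub>R (c - w (snd p) *\<^sub>R fst p),
    (\<sigma> (snd p) / \<delta> (snd p))\<^sup>2)"
  unfolding height_gradient_def
proof (rule gradient_on_eqI)
  have q: "fst p \<bullet> fst p = 1" "fst p \<bullet> c = w (snd p)" "c \<bullet> fst p = w (snd p)"
    using p by (auto simp: surf_def dot_square_norm inner_commute)
  have \<delta>: "(\<delta> (snd p))\<^sup>2 \<noteq> 0" using \<delta>_pos[of "snd p"] by simp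
  show "subspace (tangent_space surf p)"
    unfolding tangent_space_surf[OF p] subspace_def by (auto simp: inner_add_left algebra_simps)
  show "(snd has_derivative snd) (at p within surf)"
    by (auto intro!: derivative_eq_intros)
  show "((w' (snd p) / (\<delta> (snd p))\<^sup>2) *\<^sub>R (c - w (snd p) *\<^sub>R fst p), (\<sigma> (snd p) / \<delta> (snd p))\<^sup>2)
      \<in> tangent_space surf p"
    unfolding power_divide \<sigma>_square using q inner_c
    by (simp add: tangent_space_surf[OF p] inner_diff_left power2_eq_square)
  fix v assume "v \<in> tangent_space surf p"
  then have v: "fst p \<bullet> fst v = 0" "c \<bullet> fst v = w' (snd p) * snd v"
    by (simp_all add: tangent_space_surf[OF p] inner_commute)
  have "((w' (snd p) / (\<delta> (snd p))\<^sup>2) *\<^sub>R (c - w (snd p) *\<^sub>R fst p), (\<sigma> (snd p) / \<delta> (snd p))\<^sup>2) \<bullet> v =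
      ((w' (snd p))\<^sup>2 + (\<sigma> (snd p))\<^sup>2) / (\<delta> (snd p))\<^sup>2 * snd v"
    using v by (simp add: inner_prod_def inner_diff_left power_divide power2_eq_square add_divide_distrib
        algebra_simps)
  also have "\<dots> = snd v" using \<delta> unfolding \<delta>_square[of "snd p"] by (auto simp: add.commute)
  finally show "((w' (snd p) / (\<delta> (snd p))\<^sup>2) *\<^sub>R (c - w (snd p) *\<^sub>R fst p), (\<sigma> (snd p) / \<delta> (snd p))\<^sup>2) \<bullet> v = snd v" .
qed

text \<open>The principal curvature of the height gradient is the derivative of minus the angle function
  with respect to the height.\<close>

definition curvature :: "real \<Rightarrow> real" where
  "curvature t = w'' t / \<delta> t - w' t * (w' t * w'' t - w t * w' t) / \<delta> t ^ 3"

section \<open>Shape operator and mean curvature of the sections\<close>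

lemma angle_derivative: "((\<lambda>t. w' t * inverse (\<delta> t)) has_real_derivative curvature t) (at t)"
  using \<delta>_pos[of t]
  by (auto intro!: derivative_eq_intros w'' \<delta>'
      simp: curvature_def field_simps power2_eq_square power3_eq_cube)

lemma normal_derivative:
  "(normal has_derivative (\<lambda>v.
     (inverse (\<delta> (snd p)) *\<^sub>R (- (w (snd p) *\<^sub>R fst v + (w' (snd p) * snd v) *\<^sub>R fst p)) +
      (- ((w' (snd p) * w'' (snd p) - w (snd p) * w' (snd p)) / \<delta> (snd p) ^ 3) * snd v) *\<^sub>R (c - w (snd p) *\<^sub>R fst p),
      - (curvature (snd p) * snd v)))) (at p within S)"
proof -
  let ?t = "snd p"
  have "((\<lambda>t. inverse (\<delta> t)) has_real_derivative
      - ((w' ?t * w'' ?t - w ?t * w' ?t) / \<delta> ?t ^ 3)) (at ?t)"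
    using \<delta>_pos[of ?t]
    by (auto intro!: derivative_eq_intros \<delta>' simp: field_simps power3_eq_cube)
  note D = this[unfolded has_field_derivative_def] w'[of ?t, unfolded has_field_derivative_def]
    angle_derivative[of ?t, unfolded has_field_derivative_def]
  have D1: "((\<lambda>q. inverse (\<delta> (snd q))) has_derivative
      (\<lambda>v. - ((w' ?t * w'' ?t - w ?t * w' ?t) / \<delta> ?t ^ 3) * snd v)) (at p within S)"
    by (rule has_derivative_compose[OF has_derivative_snd[OF has_derivative_ident] D(1)])
  have D2: "((\<lambda>q. w (snd q)) has_derivative (\<lambda>v. w' ?t * snd v)) (at p within S)"
    by (rule has_derivative_compose[OF has_derivative_snd[OF has_derivative_ident] D(2)])
  have D3: "((\<lambda>q. w' (snd q) * inverse (\<delta> (snd q))) has_derivative (\<lambda>v. curvature ?t * snd v)) (at p within S)"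
    by (rule has_derivative_compose[OF has_derivative_snd[OF has_derivative_ident] D(3)])
  have "((\<lambda>q. c - w (snd q) *\<^sub>R fst q) has_derivative
      (\<lambda>v. - (w ?t *\<^sub>R fst v + (w' ?t * snd v) *\<^sub>R fst p))) (at p within S)"
    using has_derivative_diff[OF has_derivative_const[of c]
        has_derivative_scaleR[OF D2 has_derivative_fst[OF has_derivative_ident]]] by simp
  from has_derivative_Pair[OF has_derivative_scaleR[OF D1 this] has_derivative_minus[OF D3]]
  show ?thesis unfolding normal_def[abs_def] by simp
qed

text \<open>By the symmetry, the derivative of \<open>normal\<close> along the gradient lies in the
  span of the gradient and the position vector \<open>fst p\<close>, and the covariant derivative
  discards the latter.\<close>

lemma shape_operator_height_gradient:
  assumes p: "p \<in> surf"
  shows "shape_operator sphere_line surf normal p (height_gradient surf p) =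
    curvature (snd p) *\<^sub>R height_gradient surf p"
proof -
  let ?t = "snd p"
  define X where "X = c - w ?t *\<^sub>R fst p"
  define b where "b = (\<sigma> ?t / \<delta> ?t)\<^sup>2"
  define a where "a = w' ?t / (\<delta> ?t)\<^sup>2"
  define d where "d = - ((w' ?t * w'' ?t - w ?t * w' ?t) / \<delta> ?t ^ 3)"
  have g: "height_gradient surf p = (a *\<^sub>R X, b)"
    unfolding height_gradient_surf[OF p] X_def a_def b_def ..
  have pl: "p \<in> sphere_line" using p surf_subset by blast
  have q: "fst p \<bullet> fst p = 1" "X \<bullet> fst p = 0"
    using p inner_commute[of c "fst p"] by (auto simp: surf_def dot_square_norm X_def inner_diff_left)
  have "X \<bullet> c = (\<sigma> ?t)\<^sup>2"
    unfolding \<sigma>_square using p inner_c by (simp add: X_def inner_diff_left surf_def power2_eq_square)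
  then have "(a *\<^sub>R X, b) \<in> tangent_space surf p"
    using q by (simp add: tangent_space_surf[OF p] a_def b_def power_divide)
  from frechet_derivative_tangent[OF this normal_derivative]
  have "frechet_derivative normal (at p within surf) (a *\<^sub>R X, b) =
    (inverse (\<delta> ?t) *\<^sub>R (- (w ?t *\<^sub>R (a *\<^sub>R X) + (w' ?t * b) *\<^sub>R fst p)) + (d * b) *\<^sub>R X, - (curvature ?t * b))"
    by (simp add: X_def d_def)
  also have "\<dots> = - curvature ?t *\<^sub>R (a *\<^sub>R X, b) + (- (inverse (\<delta> ?t) * w' ?t * b) *\<^sub>R fst p, 0)"
  proof -
    have s: "(\<sigma> ?t)\<^sup>2 = (\<delta> ?t)\<^sup>2 - (w' ?t)\<^sup>2" using \<delta>_square[of ?t] by simp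
    \<comment> \<open>Only the coefficient of \<open>X\<close> needs an argument, namely
      \<open>\<delta>\<^sup>2 = \<sigma>\<^sup>2 + w'\<^sup>2\<close>; the vertical components agree
      by inspection.\<close>
    have "- inverse (\<delta> ?t) * w ?t * a + d * b = - curvature ?t * a"
      unfolding a_def b_def d_def curvature_def power_divide s using \<delta>_pos[of ?t]
      by (simp add: field_simps power2_eq_square power3_eq_cube)
    then have "(- inverse (\<delta> ?t) * w ?t * a + d * b) *\<^sub>R X = (- curvature ?t * a) *\<^sub>R X" by simp
    then show ?thesis by (simp add: algebra_simps)
  qed
  finally have D: "frechet_derivative normal (at p within surf) (a *\<^sub>R X, b) =
    - curvature ?t *\<^sub>R (a *\<^sub>R X, b) + (- (inverse (\<delta> ?t) * w' ?t * b) *\<^sub>R fst p, 0)" .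
  have "cov_deriv sphere_line surf normal p (a *\<^sub>R X, b) = - curvature ?t *\<^sub>R (a *\<^sub>R X, b)"
    unfolding cov_deriv_def D
  proof (rule orth_proj_eqI)
    show "subspace (tangent_space sphere_line p)"
      unfolding tangent_space_sphere_line[OF pl] subspace_def by (auto simp: inner_add_left)
    show "- curvature ?t *\<^sub>R (a *\<^sub>R X, b) \<in> tangent_space sphere_line p"
      using q by (simp add: tangent_space_sphere_line[OF pl])
  next
    fix u assume "u \<in> tangent_space sphere_line p"
    then have "fst p \<bullet> fst u = 0" by (simp add: tangent_space_sphere_line[OF pl] inner_commute)
    then show "(- curvature ?t *\<^sub>R (a *\<^sub>R X, b) + (- (inverse (\<delta> ?t) * w' ?t * b) *\<^sub>R fst p, 0) -
        - curvature ?t *\<^sub>R (a *\<^sub>R X, b)) \<bullet> u = 0"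
      by (simp add: inner_prod_def)
  qed
  then show ?thesis by (simp add: shape_operator_def g)
qed

text \<open>At a fixed height the section normal is an affine function of the position, so the shape
  operator is the scalar \<open>- w / \<sigma>\<close>. The result
  \<open>- (n - 1) cot \<rho>\<close> is the mean curvature of a geodesic sphere for the normal
  pointing away from its centre.\<close>

lemma section_mean_curvature_surf:
  assumes p: "p \<in> surf"
  shows "section_mean_curvature surf normal p = - (real (DIM('a) - 2) * w (snd p) / \<sigma> (snd p))"
proof -
  let ?t = "snd p"
  let ?S = "surf \<inter> sphere_slice ?t"
  have ps: "p \<in> sphere_slice ?t" "p \<in> ?S"
    using p surf_subset by (auto simp: sphere_slice_def sphere_line_def mem_Times_iff)
  have T: "tangent_space (sphere_slice ?t) p = {v. fst v \<bullet> fst p = 0 \<and> snd v = 0}"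
    by (rule tangent_space_sphere_slice[OF ps(1)])
  have N: "section_normal normal q = ((1 / \<sigma> ?t) *\<^sub>R (w ?t *\<^sub>R fst q - c), 0)" if "q \<in> ?S" for q
  proof -
    have "snd q = ?t" using that by (auto simp: sphere_slice_def)
    then show ?thesis
      unfolding section_normal_def sqrt_angle_normal unfolding angle_fun_normal
      using \<delta>_pos[of ?t] \<sigma>_pos[of ?t]
      by (simp add: normal_def vertical_field_def field_simps)
  qed
  have "((\<lambda>q :: 'a \<times> real. ((1 / \<sigma> ?t) *\<^sub>R (w ?t *\<^sub>R fst q - c), 0 :: real)) has_derivative
      (\<lambda>v. ((w ?t / \<sigma> ?t) *\<^sub>R fst v, 0))) (at p within ?S)"
    by (auto intro!: derivative_eq_intros)
  then have N': "(section_normal normal has_derivative (\<lambda>v. ((w ?t / \<sigma> ?t) *\<^sub>R fst v, 0))) (at p within ?S)"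
    by (rule has_derivative_transform[OF ps(2), rotated]) (rule N)
  have "shape_operator (sphere_slice ?t) ?S (section_normal normal) p v = (- (w ?t / \<sigma> ?t)) *\<^sub>R v"
    if v: "v \<in> tangent_space ?S p" for v
  proof -
    have v': "snd v = 0" "fst v \<bullet> fst p = 0" using v tangent_space_section[OF p refl] by auto
    have "orth_proj (tangent_space (sphere_slice ?t) p) ((w ?t / \<sigma> ?t) *\<^sub>R fst v, 0) = ((w ?t / \<sigma> ?t) *\<^sub>R fst v, 0)"
      by (rule orth_proj_eqI) (use v' in \<open>auto simp: T subspace_def inner_add_left\<close>)
    then show ?thesis
      using v' by (simp add: shape_operator_def cov_deriv_def frechet_derivative_tangent[OF v N'] prod_eq_iff)
  qed
  from trace_on_scaled[OF dim_tangent_space_section(1)[OF p refl] this]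
  have "section_mean_curvature surf normal p = - (w ?t / \<sigma> ?t) * real (dim (tangent_space ?S p))"
    by (simp add: section_mean_curvature_def mean_curvature_def)
  moreover have "dim (tangent_space ?S p) = DIM('a) - 2"
    using dim_tangent_space_section(2)[OF p refl] by linarith
  ultimately show ?thesis by simp
qed

lemma height_gradient_pos: "p \<in> surf \<Longrightarrow> snd (height_gradient surf p) > 0"
  using \<sigma>_pos[of "snd p"] \<delta>_pos[of "snd p"] by (simp add: height_gradient_surf)

text \<open>Over the denominator \<open>\<delta> t ^ 3\<close> the numerator of
  \<open>curvature t\<close> collapses to the left side of the assumption, whose right side contains
  the factor \<open>(\<delta> t)\<^sup>2\<close>. With \<open>a = n - 1\<close> this is condition
  (ii), because \<open>sqrt (1 - \<Theta>\<^sup>2) = \<sigma> / \<delta>\<close>.\<close>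

lemma curvature_eqI:
  assumes "w'' t * (1 - (w t)\<^sup>2) + w t * (w' t)\<^sup>2 = - a * w t * (1 - (w t)\<^sup>2 + (w' t)\<^sup>2)"
  shows "curvature t = - (a * w t / \<delta> t)"
proof -
  have d: "\<delta> t \<noteq> 0" using \<delta>_pos[of t] by simp
  have "curvature t = (w'' t * (\<delta> t)\<^sup>2 - w' t * (w' t * w'' t - w t * w' t)) / \<delta> t ^ 3"
    using d by (simp add: curvature_def field_simps power2_eq_square power3_eq_cube)
  also have "w'' t * (\<delta> t)\<^sup>2 - w' t * (w' t * w'' t - w t * w' t) = w'' t * (1 - (w t)\<^sup>2) + w t * (w' t)\<^sup>2"
    unfolding \<delta>_square \<sigma>_square by (simp add: algebra_simps power2_eq_square)
  also have "\<dots> = - a * w t * (\<delta> t)\<^sup>2"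
    unfolding assms \<delta>_square \<sigma>_square ..
  finally show ?thesis using d by (simp add: field_simps power2_eq_square power3_eq_cube)
qed

section \<open>Symmetry, the catenoid conditions and topology\<close>

lemma rotational_about_surf: "rotational_about c surf"
  unfolding rotational_about_def
proof (intro conjI allI impI)
  fix t
  have "0 < arccos (w t) \<and> arccos (w t) < pi"
    using w_less[of t] by (intro arccos_lt_bounded) auto
  moreover have "surf \<inter> sphere_slice t \<subseteq> geodesic_sphere c (arccos (w t)) \<times> {t}"
    by (auto simp: surf_def sphere_slice_def geodesic_sphere_def inner_commute)
  ultimately show "\<exists>R>0. R < pi \<and> surf \<inter> sphere_slice t \<subseteq> geodesic_sphere c R \<times> {t}"
    by blast
qed (simp add: norm_c)

lemma vertically_periodic_surf:
  assumes "P \<noteq> 0" "\<And>t. w (t + P) = w t"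
  shows "vertically_periodic surf"
proof -
  have "(\<lambda>(x, t). (x, t + P)) ` surf = surf"
  proof (intro equalityI subsetI)
    fix p assume p: "p \<in> surf"
    then have "(fst p, snd p - P) \<in> surf" using assms(2)[of "snd p - P"] by (simp add: surf_def)
    then show "p \<in> (\<lambda>(x, t). (x, t + P)) ` surf"
      by (rule rev_image_eqI) simp
  qed (use assms in \<open>auto simp: surf_def\<close>)
  then show ?thesis using assms(1) unfolding vertically_periodic_def by blast
qed

text \<open>Principal curvature and mean curvature are both \<open>w\<close> times nowhere vanishing
  factors, so the zeros of \<open>w\<close> form the exceptional set. The angle function vanishes at
  height \<open>t0\<close> but not at \<open>t1\<close>, hence is not constant.\<close>

lemma vertical_catenoid_surf:
  assumes dim: "DIM('a) > 2"
    and eq: "\<And>t. w'' t * (1 - (w t)\<^sup>2) + w t * (w' t)\<^sup>2 =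
      - real (DIM('a) - 2) * w t * (1 - (w t)\<^sup>2 + (w' t)\<^sup>2)"
    and crit: "w' t0 = 0" "w' t1 \<noteq> 0"
    and zeros: "\<And>a b. finite ({t. w t = 0} \<inter> {a..b})"
  shows "vertical_catenoid surf"
proof -
  define H where "H t = - (real (DIM('a) - 2) * w t / \<sigma> t)" for t
  have curv: "curvature t = - (real (DIM('a) - 2) * w t / \<delta> t)" for t
    by (rule curvature_eqI[OF eq])
  have "DIM('a) \<ge> 2" using dim by simp
  then obtain y where y: "norm y = 1" "y \<bullet> c = 0"
    using exists_unit_orthogonal[where c = c] by blast
  have "\<not> angle_fun normal constant_on surf"
  proof
    assume "angle_fun normal constant_on surf"
    then have "angle_fun normal (point y t0) = angle_fun normal (point y t1)"
      using point_in_surf[OF y] unfolding constant_on_def by metis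
    then show False using crit \<delta>_pos[of t1] by (simp add: angle_fun_normal)
  qed
  moreover have "\<not> (\<exists>p. horizontal_point surf p)"
    using height_gradient_pos by (force simp: horizontal_point_def)
  moreover have "\<forall>p\<in>surf. shape_operator sphere_line surf normal p (height_gradient surf p) =
      curvature (snd p) *\<^sub>R height_gradient surf p \<and> (snd p \<notin> {t. w t = 0} \<longrightarrow> curvature (snd p) \<noteq> 0)"
    using shape_operator_height_gradient dim \<delta>_pos by (simp add: curv less_imp_neq[symmetric])
  moreover have "(t \<notin> {t. w t = 0} \<longrightarrow> H t \<noteq> 0) \<and>
      (\<forall>p\<in>surf \<inter> sphere_slice t. section_mean_curvature surf normal p = H t \<and>
        H t = curvature (snd p) / sqrt (1 - (angle_fun normal p)\<^sup>2))" for t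
  proof (intro conjI ballI impI)
    show "H t \<noteq> 0" if "t \<notin> {t. w t = 0}" using that dim \<sigma>_pos[of t] by (simp add: H_def)
    fix p assume p: "p \<in> surf \<inter> sphere_slice t"
    then have t: "snd p = t" by (auto simp: sphere_slice_def)
    show "section_mean_curvature surf normal p = H t"
      using section_mean_curvature_surf[of p] p by (simp add: H_def t)
    show "H t = curvature (snd p) / sqrt (1 - (angle_fun normal p)\<^sup>2)"
      unfolding sqrt_angle_normal curv t H_def using \<delta>_pos[of t] \<sigma>_pos[of t] by simp
  qed
  ultimately have "vertical_catenoid_off {t. w t = 0} surf"
    unfolding vertical_catenoid_off_def
    using hypersurface_surf[OF \<open>DIM('a) \<ge> 2\<close>] unit_normal_surf
    by (intro conjI exI[of _ normal] exI[of _ "\<lambda>p. curvature (snd p)"]) blast+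
  then show ?thesis using zeros unfolding vertical_catenoid_def by blast
qed

text \<open>A linear isometry from \<open>'b\<close> onto the hyperplane orthogonal to
  \<open>c\<close> carries its unit sphere to the directions \<open>y\<close>; polar coordinates do
  the rest.\<close>

lemma homeomorphic_surf:
  assumes dim: "DIM('a) = DIM('b::euclidean_space) + 1"
  shows "surf homeomorphic (sphere (0::'b) 1 \<times> (UNIV :: real set))"
proof -
  let ?T = "{x. c \<bullet> x = 0}"
  have "c \<noteq> 0" using norm_c by auto
  then have "dim ?T = dim (UNIV :: 'b set)" using dim dim_hyperplane[of c] by simp
  then have "dim (UNIV :: 'b set) = dim ?T" ..
  then obtain f :: "'b \<Rightarrow> 'a" and g where fg: "linear f" "linear g" "f ` UNIV = ?T" "g ` ?T = UNIV"
      "\<And>x. x \<in> UNIV \<Longrightarrow> norm (f x) = norm x" "\<And>x. x \<in> ?T \<Longrightarrow> norm (g x) = norm x"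
      "\<And>x. x \<in> UNIV \<Longrightarrow> g (f x) = x" "\<And>x. x \<in> ?T \<Longrightarrow> f (g x) = x"
    by (rule isometries_subspaces[OF subspace_UNIV subspace_hyperplane[of c]]) blast
  have cont: "continuous_on UNIV w" "continuous_on UNIV \<sigma>"
    by (rule DERIV_continuous_on, rule w' \<sigma>')+
  have snd: "continuous_on A (\<lambda>p. h (snd p))" if "continuous_on UNIV h"
    for h :: "real \<Rightarrow> real" and A :: "('c::euclidean_space \<times> real) set"
    using continuous_on_compose2[OF that continuous_on_snd[OF continuous_on_id], of A] by simp
  define F where "F q = point (f (fst q)) (snd q)" for q :: "'b \<times> real"
  define Y where "Y p = inverse (\<sigma> (snd p)) *\<^sub>R (fst p - w (snd p) *\<^sub>R c)" for p
  define K where "K p = (g (Y p), snd p)" for p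
  have f0: "f x \<bullet> c = 0" for x
  proof -
    have "f x \<in> ?T" using fg(3) by blast
    then show ?thesis by (simp add: inner_commute)
  qed
  have Y: "norm (Y p) = 1" "Y p \<in> ?T" "p = point (Y p) (snd p)" if "p \<in> surf" for p
    using surf_coordinates[OF that] by (simp_all add: Y_def inner_commute)
  have Yp: "Y (point y t) = y" for y t
    using \<sigma>_pos[of t] by (simp add: Y_def point_def)
  have "homeomorphism surf (sphere (0::'b) 1 \<times> UNIV) K F"
  proof (rule homeomorphismI)
    show "continuous_on surf K"
      unfolding K_def Y_def using \<sigma>_pos
      by (intro continuous_on_Pair continuous_intros snd cont
            linear_continuous_on_compose[OF _ fg(2)]) (auto simp: less_imp_neq[symmetric])
    show "continuous_on (sphere 0 1 \<times> UNIV) F"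
      unfolding F_def point_def
      by (intro continuous_on_Pair continuous_intros snd cont linear_continuous_on_compose[OF _ fg(1)])
    show "K ` surf \<subseteq> sphere 0 1 \<times> UNIV" using Y fg(6) by (auto simp: K_def)
    show "F ` (sphere 0 1 \<times> UNIV) \<subseteq> surf"
      using fg(5) f0 by (auto simp: F_def intro!: point_in_surf)
    show "F (K p) = p" if "p \<in> surf" for p
      using Y[OF that] fg(8) by (simp add: F_def K_def)
    show "K (F q) = q" if "q \<in> sphere 0 1 \<times> UNIV" for q
      using fg(7) by (simp add: K_def F_def Yp)
  qed
  then show ?thesis unfolding homeomorphic_def by blast
qed

section \<open>Trajectories of the height gradient\<close>

text \<open>As \<open>\<sigma>' = - w w' / \<sigma>\<close>, the right side is
  \<open>(\<sigma> t / \<delta> t)\<^sup>2\<close> times the velocity of \<open>point y\<close> at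
  \<open>t\<close>: the meridians are trajectories up to parametrization.\<close>

lemma height_gradient_point:
  assumes "norm y = 1" "y \<bullet> c = 0"
  shows "height_gradient surf (point y t) =
    ((\<sigma> t / \<delta> t)\<^sup>2 *\<^sub>R (w' t *\<^sub>R c + (- w t * w' t / \<sigma> t) *\<^sub>R y), (\<sigma> t / \<delta> t)\<^sup>2)"
proof -
  have "c - w t *\<^sub>R (w t *\<^sub>R c + \<sigma> t *\<^sub>R y) = (1 - (w t)\<^sup>2) *\<^sub>R c - (w t * \<sigma> t) *\<^sub>R y"
    by (simp add: algebra_simps power2_eq_square)
  then have "(w' t / (\<delta> t)\<^sup>2) *\<^sub>R (c - w t *\<^sub>R (w t *\<^sub>R c + \<sigma> t *\<^sub>R y)) =
      (w' t / (\<delta> t)\<^sup>2 * (\<sigma> t)\<^sup>2) *\<^sub>R c - (w' t / (\<delta> t)\<^sup>2 * (w t * \<sigma> t)) *\<^sub>R y"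
    by (simp add: \<sigma>_square scaleR_diff_right)
  also have "\<dots> = (\<sigma> t / \<delta> t)\<^sup>2 *\<^sub>R (w' t *\<^sub>R c + (- w t * w' t / \<sigma> t) *\<^sub>R y)"
    using \<sigma>_pos[of t] by (simp add: scaleR_add_right scaleR_diff_right power2_eq_square mult_ac)
  finally show ?thesis
    using height_gradient_surf[OF point_in_surf[OF assms]] by (simp add: fst_point)
qed

text \<open>Along every integral curve two quantities are constant: the direction \<open>Y\<close>
  and \<open>G (\<tau> s) - s\<close>, where \<open>G\<close> is the time map of the height equation
  \<open>\<tau>' = g \<tau>\<close>. They exhibit the curve as a restriction of one defined for all
  times, which exists since \<open>0 < g \<le> 1\<close>; maximality then makes the domain the whole
  line.\<close>

lemma trajectory_surf:
  assumes "trajectory surf (height_gradient surf) C"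
  obtains y where "norm y = 1" "y \<bullet> c = 0" "C = range (point y)"
proof -
  obtain I \<alpha> where \<alpha>: "integral_curve surf (height_gradient surf) I \<alpha>"
    and max: "\<And>J \<beta>. integral_curve surf (height_gradient surf) J \<beta> \<Longrightarrow> I \<subseteq> J \<Longrightarrow>
        \<forall>s\<in>I. \<beta> s = \<alpha> s \<Longrightarrow> J = I"
    and C: "C = \<alpha> ` I"
    using assms unfolding trajectory_def by blast
  define g where "g t = (\<sigma> t / \<delta> t)\<^sup>2" for t
  have g_pos: "g t > 0" for t using \<sigma>_pos[of t] \<delta>_pos[of t] by (simp add: g_def)
  have g_le: "g t \<le> 1" for t
  proof -
    have "(\<sigma> t)\<^sup>2 \<le> (\<delta> t)\<^sup>2" by (simp add: \<delta>_square)
    then show ?thesis using \<delta>_pos[of t] by (simp add: g_def power_divide)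
  qed
  have "continuous_on UNIV \<sigma>" "continuous_on UNIV \<delta>"
    by (rule DERIV_continuous_on, rule \<sigma>' \<delta>')+
  then have "continuous_on UNIV g"
    unfolding g_def[abs_def] using \<delta>_pos by (intro continuous_intros) (auto simp: less_imp_neq[symmetric])
  then obtain G \<phi> where "G 0 = 0"
    and G: "\<And>x. (G has_real_derivative 1 / g x) (at x)"
    and inv: "\<And>x. \<phi> (G x) = x" "\<And>t. G (\<phi> t) = t"
    and \<phi>: "\<And>t. (\<phi> has_real_derivative g (\<phi> t)) (at t)"
    by (rule autonomous_ode[OF _ g_pos g_le]) iprover
  define \<tau> where "\<tau> s = snd (\<alpha> s)" for s
  define Y where "Y s = inverse (\<sigma> (\<tau> s)) *\<^sub>R (fst (\<alpha> s) - w (\<tau> s) *\<^sub>R c)" for s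
  have I: "open I" "convex I" "I \<noteq> {}"
    using \<alpha> by (auto simp: integral_curve_def is_interval_convex)
  have Y: "norm (Y s) = 1" "Y s \<bullet> c = 0" "\<alpha> s = point (Y s) (\<tau> s)" if "s \<in> I" for s
    using surf_coordinates[of "\<alpha> s"] \<alpha> that by (auto simp: Y_def \<tau>_def integral_curve_def)
  have \<alpha>': "(\<alpha> has_vector_derivative
      (g (\<tau> s) *\<^sub>R (w' (\<tau> s) *\<^sub>R c + (- w (\<tau> s) * w' (\<tau> s) / \<sigma> (\<tau> s)) *\<^sub>R Y s), g (\<tau> s))) (at s)"
    if "s \<in> I" for s
    using \<alpha> that height_gradient_point[OF Y(1,2)[OF that], of "\<tau> s"] Y(3)[OF that]
    unfolding integral_curve_def g_def by metis
  have \<tau>': "(\<tau> has_real_derivative g (\<tau> s)) (at s)" if "s \<in> I" for s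
    using bounded_linear.has_vector_derivative[OF bounded_linear_snd \<alpha>'[OF that]]
    unfolding \<tau>_def[abs_def] has_real_derivative_iff_has_vector_derivative by simp
  have x': "((\<lambda>s. fst (\<alpha> s)) has_vector_derivative
      g (\<tau> s) *\<^sub>R (w' (\<tau> s) *\<^sub>R c + (- w (\<tau> s) * w' (\<tau> s) / \<sigma> (\<tau> s)) *\<^sub>R Y s)) (at s)" if "s \<in> I" for s
    using bounded_linear.has_vector_derivative[OF bounded_linear_fst \<alpha>'[OF that]] by simp
  \<comment> \<open>After subtraction of the \<open>c\<close> component, the horizontal velocity is
    \<open>Y\<close> times the derivative of \<open>\<sigma> \<circ> \<tau>\<close>; normalizing by
    \<open>\<sigma>\<close> cancels it.\<close>
  have "(Y has_vector_derivative 0) (at s within I)" if s: "s \<in> I" for s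
  proof -
    have 1: "((\<lambda>s. inverse (\<sigma> (\<tau> s))) has_real_derivative
        g (\<tau> s) * (w (\<tau> s) * w' (\<tau> s) / \<sigma> (\<tau> s) ^ 3)) (at s)"
      using \<sigma>_pos[of "\<tau> s"]
      by (auto intro!: derivative_eq_intros DERIV_chain2[OF \<sigma>' \<tau>'[OF s]] simp: power3_eq_cube field_simps)
    have 2: "((\<lambda>s. w (\<tau> s) *\<^sub>R c) has_vector_derivative (w' (\<tau> s) * g (\<tau> s)) *\<^sub>R c) (at s)"
      using has_vector_derivative_scaleR[OF DERIV_chain2[OF w' \<tau>'[OF s]] has_vector_derivative_const[of c]]
      by simp
    have e: "fst (\<alpha> s) - w (\<tau> s) *\<^sub>R c = \<sigma> (\<tau> s) *\<^sub>R Y s"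
      using \<sigma>_pos[of "\<tau> s"] by (simp add: Y_def)
    have "g (\<tau> s) *\<^sub>R (w' (\<tau> s) *\<^sub>R c + (- w (\<tau> s) * w' (\<tau> s) / \<sigma> (\<tau> s)) *\<^sub>R Y s) - (w' (\<tau> s) * g (\<tau> s)) *\<^sub>R c =
        (- (g (\<tau> s) * w (\<tau> s) * w' (\<tau> s) / \<sigma> (\<tau> s))) *\<^sub>R Y s"
      by (simp add: scaleR_diff_right mult_ac)
    with has_vector_derivative_scaleR[OF 1 has_vector_derivative_diff[OF x'[OF s] 2]]
    have "(Y has_vector_derivative inverse (\<sigma> (\<tau> s)) *\<^sub>R ((- (g (\<tau> s) * w (\<tau> s) * w' (\<tau> s) / \<sigma> (\<tau> s))) *\<^sub>R Y s) +
        (g (\<tau> s) * (w (\<tau> s) * w' (\<tau> s) / \<sigma> (\<tau> s) ^ 3)) *\<^sub>R (\<sigma> (\<tau> s) *\<^sub>R Y s)) (at s)"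
      unfolding Y_def[abs_def, symmetric] e[symmetric] by simp
    moreover have "inverse (\<sigma> (\<tau> s)) *\<^sub>R ((- (g (\<tau> s) * w (\<tau> s) * w' (\<tau> s) / \<sigma> (\<tau> s))) *\<^sub>R Y s) +
        (g (\<tau> s) * (w (\<tau> s) * w' (\<tau> s) / \<sigma> (\<tau> s) ^ 3)) *\<^sub>R (\<sigma> (\<tau> s) *\<^sub>R Y s) = 0"
    proof -
      have "inverse (\<sigma> (\<tau> s)) * (- (g (\<tau> s) * w (\<tau> s) * w' (\<tau> s) / \<sigma> (\<tau> s))) +
          (g (\<tau> s) * (w (\<tau> s) * w' (\<tau> s) / \<sigma> (\<tau> s) ^ 3)) * \<sigma> (\<tau> s) = 0"
        using \<sigma>_pos[of "\<tau> s"] by (simp add: field_simps power3_eq_cube)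
      then show ?thesis by (simp only: scaleR_scaleR scaleR_add_left[symmetric] scaleR_zero_left)
    qed
    ultimately show ?thesis by (metis has_vector_derivative_at_within)
  qed
  then obtain y where y: "\<And>s. s \<in> I \<Longrightarrow> Y s = y"
    using has_vector_derivative_zero_constant[OF I(2), of Y] by metis
  then have y1: "norm y = 1" "y \<bullet> c = 0" using Y I(3) by (metis ex_in_conv)+
  have "((\<lambda>s. G (\<tau> s) - s) has_vector_derivative 0) (at s within I)" if s: "s \<in> I" for s
  proof -
    have "((\<lambda>s. G (\<tau> s) - s) has_real_derivative 1 / g (\<tau> s) * g (\<tau> s) - 1) (at s)"
      by (auto intro!: derivative_eq_intros DERIV_chain2[OF G \<tau>'[OF s]])
    then have "((\<lambda>s. G (\<tau> s) - s) has_vector_derivative 0) (at s)"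
      using g_pos[of "\<tau> s"] by (simp add: has_real_derivative_iff_has_vector_derivative)
    then show ?thesis by (rule has_vector_derivative_at_within)
  qed
  then obtain k where k: "\<And>s. s \<in> I \<Longrightarrow> G (\<tau> s) - s = k"
    using has_vector_derivative_zero_constant[OF I(2), of "\<lambda>s. G (\<tau> s) - s"] by metis
  have \<tau>: "\<tau> s = \<phi> (s + k)" if "s \<in> I" for s
    using k[OF that] inv(1)[of "\<tau> s"] by (simp add: algebra_simps)
  define \<beta> where "\<beta> s = point y (\<phi> (s + k))" for s
  have "(\<beta> has_vector_derivative height_gradient surf (\<beta> s)) (at s)" for s
  proof -
    have \<phi>': "((\<lambda>s. \<phi> (s + k)) has_real_derivative g (\<phi> (s + k))) (at s)"
      using \<phi>[of "s + k"] by (simp add: DERIV_shift)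
    from has_vector_derivative_Pair[OF has_vector_derivative_add[OF
          has_vector_derivative_scaleR[OF DERIV_chain2[OF w' \<phi>'] has_vector_derivative_const[of c]]
          has_vector_derivative_scaleR[OF DERIV_chain2[OF \<sigma>' \<phi>'] has_vector_derivative_const[of y]]]
        \<phi>'[unfolded has_real_derivative_iff_has_vector_derivative]]
    show ?thesis
      unfolding \<beta>_def height_gradient_point[OF y1] unfolding point_def g_def[symmetric]
      by (simp add: scaleR_diff_right mult_ac)
  qed
  then have "integral_curve surf (height_gradient surf) UNIV \<beta>"
    unfolding integral_curve_def using point_in_surf[OF y1] by (auto simp: \<beta>_def)
  moreover have \<beta>: "\<forall>s\<in>I. \<beta> s = \<alpha> s" using Y(3) y \<tau> by (simp add: \<beta>_def)
  ultimately have "I = UNIV" using max by blast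
  then have "C = range \<beta>" using C \<beta> by auto
  also have "range \<beta> = range (point y)"
  proof (intro equalityI subsetI)
    fix p assume "p \<in> range (point y)"
    then obtain t where "p = point y t" by blast
    then have "p = \<beta> (G t - k)" by (simp add: \<beta>_def inv)
    then show "p \<in> range \<beta>" by blast
  qed (auto simp: \<beta>_def)
  finally show ?thesis using that y1 by blast
qed

text \<open>The meridian in direction \<open>y\<close> lies over the great circle through
  \<open>c\<close> with velocity \<open>y\<close>, at arc length \<open>arccos (w t)\<close>. For
  \<open>w0 = cos r\<close> the compact interval is \<open>[r, \<pi> - r]\<close>.\<close>

lemma unduloid_trajectory:
  assumes "trajectory surf (height_gradient surf) C"
    and P: "P > 0" "\<And>t. w (t + P) = w t"
    and bound: "\<And>t. \<bar>w t\<bar> \<le> w0" "w0 < 1"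
    and noncon: "w t0 \<noteq> w t1"
  shows "unduloid c C"
proof -
  obtain y where y: "norm y = 1" "y \<bullet> c = 0" "C = range (point y)"
    using trajectory_surf[OF assms(1)] by blast
  define \<gamma> where "\<gamma> s = cos s *\<^sub>R c + sin s *\<^sub>R y" for s
  define \<rho> where "\<rho> t = arccos (w t)" for t
  have w1: "-1 \<le> w t" "w t \<le> 1" for t using w_less[of t] by auto
  have \<gamma>_norm: "norm (\<gamma> s) = 1" and \<gamma>'_norm: "norm (- sin s *\<^sub>R c + cos s *\<^sub>R y) = 1" for s
  proof -
    have "y \<bullet> y = 1" "c \<bullet> y = 0" using y by (auto simp: dot_square_norm inner_commute)
    then have "\<gamma> s \<bullet> \<gamma> s = (cos s)\<^sup>2 + (sin s)\<^sup>2"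
      "(- sin s *\<^sub>R c + cos s *\<^sub>R y) \<bullet> (- sin s *\<^sub>R c + cos s *\<^sub>R y) = (sin s)\<^sup>2 + (cos s)\<^sup>2"
      using y(2) inner_c
      by (simp_all add: \<gamma>_def inner_add_left inner_add_right inner_diff_left inner_diff_right
          power2_eq_square del: sin_cos_squared_add3)
    then show "norm (\<gamma> s) = 1" "norm (- sin s *\<^sub>R c + cos s *\<^sub>R y) = 1" by (simp_all add: norm_eq_1)
  qed
  have "unit_speed_geodesic (sphere 0 1) \<gamma>"
  proof -
    have "(\<gamma> has_vector_derivative - sin s *\<^sub>R c + cos s *\<^sub>R y) (at s)"
      "((\<lambda>s. - sin s *\<^sub>R c + cos s *\<^sub>R y) has_vector_derivative - \<gamma> s) (at s)" for s
      unfolding \<gamma>_def[abs_def] by (auto intro!: derivative_eq_intros)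
    \<comment> \<open>The acceleration \<open>- \<gamma>\<close> is normal to the sphere.\<close>
    moreover have "orth_proj (tangent_space (sphere 0 1) (\<gamma> s)) (- \<gamma> s) = 0" for s
      using tangent_space_sphere[of "\<gamma> s"] \<gamma>_norm
      by (intro orth_proj_eqI) (auto simp: subspace_def inner_add_left inner_add_right inner_commute)
    ultimately show ?thesis
      unfolding unit_speed_geodesic_def using \<gamma>_norm \<gamma>'_norm
      by (intro conjI exI[where P = "\<lambda>\<gamma>'. \<exists>\<gamma>''. _ \<gamma>' \<gamma>''" and x = "\<lambda>s. - sin s *\<^sub>R c + cos s *\<^sub>R y"]
          exI[of _ "\<lambda>s. - \<gamma> s"]) auto
  qed
  moreover have "\<gamma> 0 = c" by (simp add: \<gamma>_def)
  moreover have "smooth_on UNIV \<rho>"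
  proof -
    have "w ` UNIV \<subseteq> {-1<..<1}" using w_less by (auto simp: abs_less_iff minus_less_iff)
    then have "Ck_on k UNIV \<rho>" for k
      unfolding \<rho>_def[abs_def] by (rule Ck_on_compose[OF Cinf_on_arccos[rule_format] Cinf_w[rule_format]])
    then show ?thesis by (intro smooth_onI[of UNIV]) simp_all
  qed
  moreover have cos\<rho>: "cos (\<rho> t) = w t" for t using w1 by (simp add: \<rho>_def)
  then have "\<not> \<rho> constant_on UNIV" using noncon unfolding constant_on_def by (metis UNIV_I)
  moreover have "\<forall>t. \<rho> (t + P) = \<rho> t" using P(2) by (simp add: \<rho>_def)
  moreover have "\<exists>a b. 0 < a \<and> a \<le> b \<and> b < pi \<and> range \<rho> \<subseteq> {a..b}"
  proof (intro exI conjI)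
    have w0: "0 \<le> w0" using bound(1)[of 0] by linarith
    show "0 < arccos w0" "arccos (- w0) < pi"
      using arccos_lt_bounded[of w0] arccos_lt_bounded[of "- w0"] w0 bound(2) by auto
    show "arccos w0 \<le> arccos (- w0)" using w0 bound(2) by (intro arccos_le_arccos) auto
    have "arccos w0 \<le> \<rho> t" "\<rho> t \<le> arccos (- w0)" for t
      unfolding \<rho>_def using bound(1)[of t] bound(2) by (auto intro!: arccos_le_arccos)
    then show "range \<rho> \<subseteq> {arccos w0..arccos (- w0)}" by auto
  qed
  moreover have "C = range (\<lambda>t. (\<gamma> (\<rho> t), t))"
  proof -
    have "sin (\<rho> t) = \<sigma> t" for t using w1 by (simp add: \<rho>_def \<sigma>_def sin_arccos)
    then have "point y t = (\<gamma> (\<rho> t), t)" for t by (simp add: point_def \<gamma>_def cos\<rho>)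
    then show ?thesis unfolding y(3) by presburger
  qed
  ultimately show ?thesis using P(1) unfolding unduloid_def by blast
qed

end

section \<open>The Delaunay profile\<close>

text \<open>The first integral of the profile equation is \<open>w'\<^sup>2 = (1 - w\<^sup>2) ((1 - w\<^sup>2)^m / s^(2 m) - 1)\<close> with
  \<open>m = n - 1\<close> and \<open>s = sin r\<close>; the right-hand side is \<open>(cos r)\<^sup>2 - w\<^sup>2\<close> times the following
  function of \<open>w\<close>, which is positive for \<open>\<bar>w\<bar> \<le> cos r\<close>. Substituting \<open>w = cos r * sin \<phi>\<close> therefore
  gives an equation for \<open>\<phi>'\<close> without turning points.\<close>

definition cofactor :: "nat \<Rightarrow> real \<Rightarrow> real \<Rightarrow> real" where
  "cofactor j S v = (1 - v\<^sup>2) / S ^ Suc j * (\<Sum>p<Suc j. (1 - v\<^sup>2) ^ p * S ^ (j - p))"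

text \<open>Factorization of a difference of powers. For \<open>S = (sin r)\<^sup>2\<close> the
  first factor is \<open>(cos r)\<^sup>2 - v\<^sup>2\<close>, and the right side is the first
  integral with \<open>m = Suc j\<close>.\<close>

lemma cofactor_eq:
  assumes "S \<noteq> 0"
  shows "(1 - v\<^sup>2 - S) * cofactor j S v = (1 - v\<^sup>2) ^ Suc (Suc j) / S ^ Suc j - (1 - v\<^sup>2)"
proof -
  have "(1 - v\<^sup>2 - S) * cofactor j S v =
      (1 - v\<^sup>2) / S ^ Suc j * ((1 - v\<^sup>2 - S) * (\<Sum>p<Suc j. (1 - v\<^sup>2) ^ p * S ^ (j - p)))"
    unfolding cofactor_def by (simp only: mult_ac)
  also have "\<dots> = (1 - v\<^sup>2) / S ^ Suc j * ((1 - v\<^sup>2) ^ Suc j - S ^ Suc j)"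
    by (simp only: diff_power_eq_sum)
  also have "\<dots> = (1 - v\<^sup>2) ^ Suc (Suc j) / S ^ Suc j - (1 - v\<^sup>2)"
    using assms by (simp add: field_simps)
  finally show ?thesis .
qed

text \<open>Positivity lets the square root be taken smoothly, and the upper bound, from
  \<open>Suc j\<close> summands of size at most 1, is the bound required by
  \<open>autonomous_ode\<close>.\<close>

lemma cofactor_bounds:
  assumes "0 < S" "S \<le> 1" "v\<^sup>2 < 1"
  shows "0 < cofactor j S v" "cofactor j S v \<le> real (Suc j) / S ^ Suc j"
proof -
  let ?A = "\<Sum>p<Suc j. (1 - v\<^sup>2) ^ p * S ^ (j - p)"
  have "0 < ?A" using assms by (intro sum_pos) auto
  then show "0 < cofactor j S v" using assms unfolding cofactor_def by simp
  have "?A \<le> (\<Sum>p<Suc j. 1)"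
    using assms by (intro sum_mono mult_le_one power_le_one) auto
  then have "(1 - v\<^sup>2) * ?A \<le> 1 * real (Suc j)"
    using assms \<open>0 < ?A\<close> by (intro mult_mono) auto
  then have "(1 - v\<^sup>2) * ?A / S ^ Suc j \<le> real (Suc j) / S ^ Suc j"
    using assms by (intro divide_right_mono) auto
  then show "cofactor j S v \<le> real (Suc j) / S ^ Suc j"
    by (simp only: cofactor_def times_divide_eq_left)
qed

text \<open>Here \<open>Suc j\<close> plays the role of \<open>n - 1\<close>. At \<open>t0\<close>
  the section has the minimal radius \<open>r\<close>, at \<open>t1\<close> it is a great
  sphere.\<close>

lemma delaunay_profile:
  fixes r :: real and j :: nat
  assumes r: "0 < r" "r < pi / 2"
  obtains w w' w'' :: "real \<Rightarrow> real" and P t0 t1 where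
    "Cinf_on UNIV w" "\<And>t. (w has_real_derivative w' t) (at t)" "\<And>t. (w' has_real_derivative w'' t) (at t)"
    "\<And>t. \<bar>w t\<bar> \<le> cos r" "w t0 = cos r" "w' t0 = 0" "w t1 = 0" "w' t1 \<noteq> 0"
    "P > 0" "\<And>t. w (t + P) = w t"
    "\<And>a b. finite ({t. w t = 0} \<inter> {a..b})"
    "\<And>t. w'' t * (1 - (w t)\<^sup>2) + w t * (w' t)\<^sup>2 = - real (Suc j) * w t * (1 - (w t)\<^sup>2 + (w' t)\<^sup>2)"
proof -
  define a where "a = cos r"
  define S where "S = (sin r)\<^sup>2"
  have S_eq: "S = 1 - a\<^sup>2" by (simp add: S_def a_def sin_squared_eq)
  have a: "0 < a" "a < 1"
    using r cos_gt_zero[of r] cos_monotone_0_pi[of 0 r] by (auto simp: a_def)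
  have S: "0 < S" "S \<le> 1"
    using r sin_gt_zero[of r] sin_le_one[of r] by (auto simp: S_def power_le_one)
  let ?R = "cofactor j S"
  define R' where "R' = deriv ?R"
  have R': "(?R has_real_derivative R' v) (at v)" for v
  proof -
    have "?R differentiable at v"
      unfolding cofactor_def[abs_def] using S by (intro derivative_intros) auto
    then show ?thesis unfolding R'_def by (simp add: DERIV_deriv_iff_real_differentiable)
  qed
  have "Ck_on k UNIV (\<lambda>v :: real. 1 - v\<^sup>2)" for k
    by (intro Ck_on_diff Ck_on_const Ck_on_power Ck_on_bounded_linear bounded_linear_ident)
  then have R_Cinf: "Ck_on k UNIV ?R" for k
    unfolding cofactor_def[abs_def] divide_inverse
    by (intro Ck_on_mult Ck_on_const Ck_on_sum Ck_on_power) auto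
  have asin: "(a * sin x)\<^sup>2 < 1" for x
  proof -
    have "(a * sin x)\<^sup>2 \<le> a\<^sup>2 * 1"
      unfolding power_mult_distrib using abs_sin_le_one[of x]
      by (intro mult_left_mono) (auto simp: abs_square_le_1)
    also have "\<dots> < 1" using S S_eq by linarith
    finally show ?thesis .
  qed
  define g where "g x = sqrt (?R (a * sin x))" for x
  note R = cofactor_bounds[OF S asin, of j]
  have g_pos: "0 < g x" for x using R(1)[of x] by (simp add: g_def)
  have g_sq: "(g x)\<^sup>2 = ?R (a * sin x)" for x using R(1)[of x] by (simp add: g_def)
  have g_le: "g x \<le> sqrt (real (Suc j) / S ^ Suc j)" for x
    unfolding g_def using R(2)[of x] by (rule real_sqrt_le_mono)
  have asin_Cinf: "Ck_on k UNIV (\<lambda>x. a * sin x)" for k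
    by (intro Ck_on_mult Ck_on_const Cinf_on_sin[rule_format])
  have "Ck_on k UNIV (\<lambda>x. ?R (a * sin x))" for k
    by (rule Ck_on_compose[OF R_Cinf asin_Cinf]) simp
  then have g_Cinf: "Cinf_on UNIV g"
    unfolding g_def[abs_def] using R(1) by (intro allI Ck_on_compose[OF Cinf_on_sqrt[rule_format]]) auto
  then have "continuous_on UNIV g" by (metis Ck_on.simps(1))
  then obtain G \<phi> where G0: "G 0 = 0"
    and G: "\<And>x. (G has_real_derivative 1 / g x) (at x)"
    and inv: "\<And>x. \<phi> (G x) = x" "\<And>t. G (\<phi> t) = t"
    and \<phi>: "\<And>t. (\<phi> has_real_derivative g (\<phi> t)) (at t)"
    by (rule autonomous_ode[OF _ g_pos g_le]) iprover
  define w where "w t = a * sin (\<phi> t)" for t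
  define w' where "w' t = a * cos (\<phi> t) * g (\<phi> t)" for t
  \<comment> \<open>Half the derivative of the first integral
    \<open>(a\<^sup>2 - v\<^sup>2) * ?R v\<close> at \<open>v = w t\<close>. That it is the
    derivative of \<open>w'\<close> is verified through \<open>\<phi>\<close>, since cancelling
    \<open>w'\<close> in the differentiated first integral fails at turning points.\<close>
  define w'' where "w'' t = (a\<^sup>2 - (w t)\<^sup>2) * R' (w t) / 2 - w t * ?R (w t)" for t
  have w: "(w has_real_derivative w' t) (at t)" for t
    unfolding w_def[abs_def] w'_def by (auto intro!: derivative_eq_intros \<phi>)
  have w'_sq: "(w' t)\<^sup>2 = (a\<^sup>2 - (w t)\<^sup>2) * ?R (w t)" for t
    unfolding w'_def w_def power_mult_distrib g_sq cos_squared_eq by (simp add: algebra_simps)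
  have g': "(g has_real_derivative R' (a * sin x) * (a * cos x) / (2 * g x)) (at x)" for x
  proof -
    have "((\<lambda>x. ?R (a * sin x)) has_real_derivative R' (a * sin x) * (a * cos x)) (at x)"
      by (rule DERIV_chain2[OF R']) (auto intro!: derivative_eq_intros)
    from DERIV_chain2[OF DERIV_real_sqrt[OF R(1)] this] show ?thesis
      unfolding g_def[abs_def] by (simp add: field_simps)
  qed
  have w': "(w' has_real_derivative w'' t) (at t)" for t
  proof -
    have D: "(w' has_real_derivative
        a * (- sin (\<phi> t) * g (\<phi> t)) * g (\<phi> t) +
        a * cos (\<phi> t) * (R' (a * sin (\<phi> t)) * (a * cos (\<phi> t)) / (2 * g (\<phi> t)) * g (\<phi> t))) (at t)"
      unfolding w'_def[abs_def]
      by (auto intro!: derivative_eq_intros \<phi> DERIV_chain2[OF g' \<phi>])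
    have e1: "a * (- sin (\<phi> t) * g (\<phi> t)) * g (\<phi> t) = - w t * ?R (w t)"
      unfolding w_def g_sq[symmetric] power2_eq_square by simp
    have e2: "a * cos (\<phi> t) * (R' (a * sin (\<phi> t)) * (a * cos (\<phi> t)) / (2 * g (\<phi> t)) * g (\<phi> t)) =
        (a\<^sup>2 * (cos (\<phi> t))\<^sup>2) * R' (w t) / 2"
      unfolding w_def using g_pos[of "\<phi> t"] by (simp add: power2_eq_square)
    have e3: "a\<^sup>2 * (cos (\<phi> t))\<^sup>2 = a\<^sup>2 - (w t)\<^sup>2"
      unfolding w_def cos_squared_eq by (simp add: algebra_simps power_mult_distrib)
    show ?thesis using D unfolding e1 e2 e3 w''_def by (simp add: algebra_simps)
  qed
  have Q: "(a\<^sup>2 - v\<^sup>2) * ?R v = (1 - v\<^sup>2) ^ Suc (Suc j) / S ^ Suc j - (1 - v\<^sup>2)" for v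
    using cofactor_eq[of S v j] S unfolding S_eq by simp
  have w''_eq: "w'' t = - w t * (real (Suc (Suc j)) * (1 - (w t)\<^sup>2) ^ Suc j / S ^ Suc j - 1)" for t
  proof -
    \<comment> \<open>The identity \<open>Q\<close> is differentiated in the free variable
      \<open>v\<close>, not along the solution, so \<open>R'\<close> can be eliminated at every
      height.\<close>
    have "((\<lambda>v. (a\<^sup>2 - v\<^sup>2) * ?R v) has_real_derivative (a\<^sup>2 - v\<^sup>2) * R' v - 2 * v * ?R v) (at v)" for v
      by (auto intro!: derivative_eq_intros R')
    moreover have "((\<lambda>v. (1 - v\<^sup>2) ^ Suc (Suc j) / S ^ Suc j - (1 - v\<^sup>2)) has_real_derivative
        real (Suc (Suc j)) * (1 - v\<^sup>2) ^ Suc j * (- 2 * v) / S ^ Suc j + 2 * v) (at v)" for v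
    proof -
      have "((\<lambda>v. 1 - v\<^sup>2) has_real_derivative - (2 * v)) (at v)"
        by (auto intro!: derivative_eq_intros)
      from DERIV_diff[OF DERIV_cdivide[OF DERIV_power[OF this, of "Suc (Suc j)"]] this]
      show ?thesis by (rule DERIV_cong) (simp only: diff_Suc_Suc diff_zero, simp)
    qed
    ultimately have "(a\<^sup>2 - v\<^sup>2) * R' v - 2 * v * ?R v =
        real (Suc (Suc j)) * (1 - v\<^sup>2) ^ Suc j * (- 2 * v) / S ^ Suc j + 2 * v" for v
      unfolding Q by (rule DERIV_unique)
    moreover have "A / 2 - v * B = - v * (N * Z / T - 1)" if "A - 2 * v * B = N * Z * (- 2 * v) / T + 2 * v"
      for A B N Z T v :: real
    proof -
      define X where "X = N * Z / T"
      have "N * Z * (- 2 * v) / T = - 2 * v * X" by (simp add: X_def)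
      then have "A = 2 * v * B - 2 * v * X + 2 * v" using that by (simp only: diff_eq_eq)
      then show ?thesis unfolding X_def[symmetric] by (simp add: algebra_simps)
    qed
    ultimately show ?thesis unfolding w''_def by blast
  qed
  have "w'' t * (1 - (w t)\<^sup>2) + w t * (w' t)\<^sup>2 = - real (Suc j) * w t * (1 - (w t)\<^sup>2 + (w' t)\<^sup>2)" for t
  proof -
    define z where "z = 1 - (w t)\<^sup>2"
    \<comment> \<open>This is \<open>(sin \<rho> / sin r)^(2 (n - 1))\<close>, that is,
      \<open>1 + \<rho>'\<^sup>2\<close>; in terms of \<open>z\<close> and \<open>y\<close> both
      sides become \<open>- real (Suc j) * w t * z * y\<close>.\<close>
    define y where "y = z ^ Suc j / S ^ Suc j"
    have 1: "(w' t)\<^sup>2 = z * y - z" unfolding w'_sq Q z_def y_def by simp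
    have 2: "w'' t = - w t * (real (Suc (Suc j)) * y - 1)"
      unfolding w''_eq z_def y_def by simp
    show ?thesis unfolding z_def[symmetric] 1 2 by (simp add: algebra_simps)
  qed
  moreover have "Cinf_on UNIV w"
  proof
    fix k
    have "Ck_on k UNIV \<phi>" by (rule Cinf_on_autonomous_ode[OF \<phi> g_Cinf, rule_format])
    then show "Ck_on k UNIV w" unfolding w_def[abs_def] by (intro Ck_on_compose[OF asin_Cinf]) auto
  qed
  moreover have "\<bar>w t\<bar> \<le> a" for t
    using a abs_sin_le_one[of "\<phi> t"] mult_left_mono[of "\<bar>sin (\<phi> t)\<bar>" 1 a] by (simp add: w_def abs_mult)
  \<comment> \<open>\<open>\<phi>\<close> equals \<open>pi / 2\<close> at time
    \<open>G (pi / 2)\<close>, where \<open>w\<close> is maximal, and 0 at time 0.\<close>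
  moreover have "w (G (pi / 2)) = a" "w' (G (pi / 2)) = 0" "w 0 = 0" "w' 0 \<noteq> 0"
    using a g_pos[of 0] inv(1)[of 0] by (simp_all add: w_def w'_def inv G0)
  moreover have G_mono: "G x < G y" if "x < y" for x y
  proof (rule DERIV_pos_imp_increasing[OF that])
    fix z show "\<exists>d. (G has_real_derivative d) (at z) \<and> 0 < d" using G[of z] g_pos[of z] by auto
  qed
  then have "G (2 * pi) > 0" using G0 by (metis pi_gt_zero zero_less_mult_iff zero_less_numeral)
  moreover have "w (t + G (2 * pi)) = w t" for t
  proof -
    \<comment> \<open>\<open>1 / g\<close> has period \<open>2 * pi\<close>, so \<open>G\<close>
      advances by the constant \<open>G (2 * pi)\<close> over that length, and \<open>\<phi>\<close>
      by \<open>2 * pi\<close> over the time \<open>G (2 * pi)\<close>.\<close>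
    have "((\<lambda>x. G (x + 2 * pi) - G x) has_real_derivative 0) (at x)" for x
    proof -
      have "((\<lambda>x. G (x + 2 * pi)) has_real_derivative 1 / g x) (at x)"
        using G[of "x + 2 * pi"] by (simp add: DERIV_shift g_def)
      from DERIV_diff[OF this G[of x]] show ?thesis by simp
    qed
    then have "G (x + 2 * pi) - G x = G (0 + 2 * pi) - G 0" for x
      using DERIV_isconst_all[of "\<lambda>x. G (x + 2 * pi) - G x" x 0] by blast
    then have "G (\<phi> t + 2 * pi) = t + G (2 * pi)"
      using inv(2)[of t] by (simp add: G0 algebra_simps)
    then have "\<phi> (t + G (2 * pi)) = \<phi> t + 2 * pi" using inv(1) by metis
    then show ?thesis by (simp add: w_def)
  qed
  moreover have "finite ({t. w t = 0} \<inter> {b..d})" for b d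
  proof (rule finite_subset)
    \<comment> \<open>At a zero \<open>\<phi> t\<close> is a multiple of \<open>pi\<close>, and
      monotonicity bounds the multiple by \<open>\<phi> b / pi\<close> and
      \<open>\<phi> d / pi\<close>.\<close>
    show "{t. w t = 0} \<inter> {b..d} \<subseteq> (\<lambda>i. G (of_int i * pi)) ` {\<lfloor>\<phi> b / pi\<rfloor>..\<lceil>\<phi> d / pi\<rceil>}"
    proof
      fix t assume t: "t \<in> {t. w t = 0} \<inter> {b..d}"
      then have "sin (\<phi> t) = 0" using a by (simp add: w_def)
      then obtain i :: int where i: "\<phi> t = of_int i * pi" using sin_zero_iff_int2 by blast
      have "\<phi> b \<le> \<phi> t" "\<phi> t \<le> \<phi> d"
        using t inv(2) G_mono by (metis IntD2 atLeastAtMost_iff leD linorder_le_less_linear)+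
      then have "\<phi> b / pi \<le> of_int i" "of_int i \<le> \<phi> d / pi" by (simp_all add: i field_simps)
      then have "i \<in> {\<lfloor>\<phi> b / pi\<rfloor>..\<lceil>\<phi> d / pi\<rceil>}" by (auto simp: floor_le_iff le_ceiling_iff)
      moreover have "t = G (of_int i * pi)" using inv(2)[of t] i by simp
      ultimately show "t \<in> (\<lambda>i. G (of_int i * pi)) ` {\<lfloor>\<phi> b / pi\<rfloor>..\<lceil>\<phi> d / pi\<rceil>}" by blast
    qed
  qed simp
  ultimately show ?thesis
    using w w' that[of w w' w'' "G (pi / 2)" 0 "G (2 * pi)"] unfolding a_def by blast
qed

section \<open>The one-parameter family\<close>

theorem theorem9:
  fixes n :: nat
  assumes "n \<ge> 2"
    and "DIM('a::euclidean_space) = n + 1"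
    and "DIM('b::euclidean_space) = n"
  shows "\<exists>S :: real \<Rightarrow> ('a \<times> real) set.
    inj_on S {0<..<pi/2} \<and>
    (\<forall>r. 0 < r \<and> r < pi/2 \<longrightarrow>
       properly_embedded sphere_line (S r) \<and>
       vertical_catenoid (S r) \<and>
       vertically_periodic (S r) \<and>
       S r homeomorphic (sphere (0::'b) 1 \<times> (UNIV :: real set)) \<and>
       (\<exists>c. rotational_about c (S r) \<and>
            (\<forall>C. trajectory (S r) (height_gradient (S r)) C \<longrightarrow> unduloid c C)))"
proof -
  obtain c :: 'a where c: "norm c = 1" using vector_choose_size[of 1] by auto
  let ?surf = "\<lambda>w. {p :: 'a \<times> real. norm (fst p) = 1 \<and> fst p \<bullet> c = w (snd p)}"
  have j: "n - 1 = Suc (n - 2)" "DIM('a) - 2 = n - 1" "DIM('a) > 2" "DIM('a) \<ge> 2" "DIM('a) = DIM('b) + 1"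
    using assms by auto
  \<comment> \<open>The first two conjuncts say that \<open>cos r\<close> is the maximum of
    \<open>w\<close>; this is how the surface remembers \<open>r\<close>.\<close>
  define delaunay where "delaunay r w \<longleftrightarrow> (\<forall>t. \<bar>w t\<bar> \<le> cos r) \<and> (\<exists>t. w t = cos r) \<and>
      properly_embedded sphere_line (?surf w) \<and> vertical_catenoid (?surf w) \<and>
      vertically_periodic (?surf w) \<and> ?surf w homeomorphic (sphere (0::'b) 1 \<times> (UNIV :: real set)) \<and>
      rotational_about c (?surf w) \<and>
      (\<forall>C. trajectory (?surf w) (height_gradient (?surf w)) C \<longrightarrow> unduloid c C)" for r w
  have "\<exists>w. delaunay r w"
    if r: "0 < r" "r < pi / 2" for r
  proof (rule delaunay_profile[OF r, of "n - 2"])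
    fix w w' w'' :: "real \<Rightarrow> real" and P t0 t1
    assume w:
      "Cinf_on UNIV w" "\<And>t. (w has_real_derivative w' t) (at t)" "\<And>t. (w' has_real_derivative w'' t) (at t)"
      "\<And>t. \<bar>w t\<bar> \<le> cos r" "w t0 = cos r" "w' t0 = 0" "w t1 = 0" "w' t1 \<noteq> 0"
      "P > 0" "\<And>t. w (t + P) = w t"
      "\<And>a b. finite ({t. w t = 0} \<inter> {a..b})"
      "\<And>t. w'' t * (1 - (w t)\<^sup>2) + w t * (w' t)\<^sup>2 =
        - real (Suc (n - 2)) * w t * (1 - (w t)\<^sup>2 + (w' t)\<^sup>2)"
    have cos: "0 < cos r" "cos r < 1"
      using r cos_gt_zero[of r] cos_monotone_0_pi[of 0 r] by auto
    interpret rotational_graph c w w' w''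
    proof
      show "\<bar>w t\<bar> < 1" for t using w(4)[of t] cos(2) by linarith
    qed (use c w in auto)
    have "vertical_catenoid surf"
      by (rule vertical_catenoid_surf[OF j(3) _ w(6,8,11)]) (use w(12) j in simp)
    moreover have "\<forall>C. trajectory surf (height_gradient surf) C \<longrightarrow> unduloid c C"
      using unduloid_trajectory[OF _ w(9,10,4) cos(2), of _ t0 t1] w(5,7) cos(1) by simp
    moreover have "surf = ?surf w" by (simp add: surf_def)
    moreover have "vertically_periodic surf" using w(9,10) by (intro vertically_periodic_surf[of P]) auto
    ultimately have "delaunay r w"
      using w(4,5) properly_embedded_surf[OF j(4)] homeomorphic_surf[OF j(5)] rotational_about_surf
      unfolding delaunay_def by auto
    then show "\<exists>w. delaunay r w" by (rule exI[of "delaunay r"])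
  qed
  then obtain W where "\<And>r. 0 < r \<Longrightarrow> r < pi / 2 \<Longrightarrow> delaunay r (W r)"
    by metis
  note W = this[unfolded delaunay_def]
  have cos_le: "cos r \<le> cos q" if r: "0 < r" "r < pi / 2" and q: "0 < q" "q < pi / 2"
    and eq: "?surf (W r) = ?surf (W q)" for r q
  proof -
    obtain t where t: "W r t = cos r" using W[OF r] by blast
    obtain y where y: "norm y = 1" "y \<bullet> c = 0"
      using exists_unit_orthogonal[where c = c] j(4) by blast
    \<comment> \<open>A point of the first surface at a height where its profile is maximal. Lying
      on the second surface too, it forces \<open>W q t = cos r\<close>, and the values of
      \<open>W q\<close> are at most \<open>cos q\<close>.\<close>
    let ?x = "cos r *\<^sub>R c + sin r *\<^sub>R y"
    have "c \<bullet> c = 1" "y \<bullet> y = 1" "c \<bullet> y = 0"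
      using c y by (simp_all add: dot_square_norm inner_commute)
    then have "?x \<bullet> ?x = (cos r)\<^sup>2 + (sin r)\<^sup>2" "?x \<bullet> c = cos r"
      using y(2) by (simp_all add: inner_add_left inner_add_right power2_eq_square del: sin_cos_squared_add3)
    then have "(?x, t) \<in> ?surf (W r)" using t by (simp add: norm_eq_1)
    then have "W q t = cos r" unfolding eq using t \<open>?x \<bullet> c = cos r\<close> by simp
    then show ?thesis using W[OF q] by (metis abs_le_iff)
  qed
  have "inj_on (\<lambda>r. ?surf (W r)) {0<..<pi/2}"
  proof (rule inj_onI)
    fix r q assume r: "r \<in> {0<..<pi/2}" and q: "q \<in> {0<..<pi/2}" and eq: "?surf (W r) = ?surf (W q)"
    have "cos r = cos q"
      using cos_le[OF _ _ _ _ eq] cos_le[OF _ _ _ _ eq[symmetric]] r q by (intro antisym) simp_all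
    then show "r = q" using cos_inj_pi[of r q] r q by simp
  qed
  moreover have "properly_embedded sphere_line (?surf (W r)) \<and> vertical_catenoid (?surf (W r)) \<and>
      vertically_periodic (?surf (W r)) \<and>
      ?surf (W r) homeomorphic (sphere (0::'b) 1 \<times> (UNIV :: real set)) \<and>
      (\<exists>c. rotational_about c (?surf (W r)) \<and>
        (\<forall>C. trajectory (?surf (W r)) (height_gradient (?surf (W r))) C \<longrightarrow> unduloid c C))"
    if "0 < r \<and> r < pi / 2" for r
    using W[OF that[THEN conjunct1] that[THEN conjunct2]]
    by (elim conjE) (intro conjI exI[of _ c]; assumption)
  ultimately show ?thesis
    by (intro exI[of _ "\<lambda>r. ?surf (W r)"] conjI allI impI) simp_all
qed

end
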